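(* Let $\alpha,\gamma,\kappa>-1$ be real numbers with $\alpha+\kappa>-\frac32$. The algebra $\mathfrak{D}_{\alpha,\gamma,\kappa}$ of linear differential operators with real polynomial coefficients in $u$ and $v$ for which every $q_{n,k}^{\alpha,\gamma,\kappa}$ $(n,k\in\mathbb{N}_0)$ is an eigenfunction is isomorphic to the real polynomial ring in two variables.
   Context: A linear differential operator with real polynomial coefficients is a finite sum $\sum_{r,s\ge0}a_{r,s}(u,v)\partial_u^r\partial_v^s$ with $a_{r,s}\in\mathbb{R}[u,v]$; the product in $\mathfrak{D}_{\alpha,\gamma,\kappa}$ is composition. Eigenfunction means $\mathcal D[q_{n,k}]=\Lambda_{\mathcal D}(n,k)\,q_{n,k}$ for some scalar $\Lambda_{\mathcal D}(n,k)$ (possibly zero). All scalars are real. Let $\mathbf{T}^2=\{(x,y)\in\mathbb{R}^2:\ x\ge0,\ y\ge0,\ x+y\le1\}$, $\triangle=\{(x,y)\in\mathbf{T}^2:\ y<x\}$, and \[ w_{\alpha,\gamma,\kappa}(x,y)=(xy)^{\alpha}(1-x-y)^{\gamma}|x-y|^{2\kappa+1}. \] Order on $\mathbb{N}_0^2$ (with $\mathbb{N}_0$ the nonnegative integers): $(m,l)\prec(n,k)$ if and only if $m+2l<n+2k$, or $m+2l=n+2k$ and $l<k$; this is a strict total order. Every symmetric polynomial (invariant under interchange of $x$ and $y$) is uniquely a finite linear combination of the monomials $(x+y)^n(xy)^k$; the largest pair $(n,k)$ (for $\prec$) occurring with nonzero coefficient is its symmetric degree. The monic orthogonal basis $p_{n,k}^{\alpha,\gamma,\kappa}$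 is obtained by Gram--Schmidt: $p_{n,k}^{\alpha,\gamma,\kappa}$ is the unique symmetric polynomial equal to $(x+y)^n(xy)^k$ plus a linear combination of $(x+y)^m(xy)^l$ with $(m,l)\prec(n,k)$, and satisfying $\int_{\triangle}p_{n,k}^{\alpha,\gamma,\kappa}\,q\,w_{\alpha,\gamma,\kappa}\,dx\,dy=0$ for every symmetric polynomial $q$ of symmetric degree $\prec(n,k)$. The polynomial $q_{n,k}^{\alpha,\gamma,\kappa}(u,v)$ is defined by $q_{n,k}^{\alpha,\gamma,\kappa}(x+y,xy)=p_{n,k}^{\alpha,\gamma,\kappa}(x,y)$. Equivalently, the $q_{n,k}^{\alpha,\gamma,\kappa}$ are the monic (leading term $u^nv^k$ for $\prec$) orthogonal polynomials for the weight $v^\alpha(1-u)^\gamma(u^2-4v)^\kappa$ on $\Omega=\{(u,v):0<u<1,\ 0<v<u^2/4\}$. *)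

theory Defs
  imports "HOL-Analysis.Analysis" "HOL-Computational_Algebra.Polynomial"
begin

text \<open>
  Polynomials in two variables are elements of \<open>real poly poly\<close>, i.e. \<open>\<real>[u][v]\<close>:
  the inner variable is the first one (\<open>u\<close> or \<open>x\<close>), the outer variable is the second one
  (\<open>v\<close> or \<open>y\<close>).
\<close>

type_synonym poly2 = "real poly poly"

abbreviation fst_var :: poly2 where "fst_var \<equiv> [:[:0, 1:]:]"

abbreviation snd_var :: poly2 where "snd_var \<equiv> [:0, 1:]"

definition scale2 :: "real \<Rightarrow> poly2 \<Rightarrow> poly2" where
  "scale2 c P = smult [:c:] P"

definition eval2 :: "poly2 \<Rightarrow> real \<Rightarrow> real \<Rightarrow> real" where
  "eval2 P a b = poly (poly P [:b:]) a"

definition triangle :: "(real \<times> real) set" where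
  "triangle = {(x, y). 0 \<le> x \<and> 0 \<le> y \<and> x + y \<le> 1 \<and> y < x}"

definition weight :: "real \<Rightarrow> real \<Rightarrow> real \<Rightarrow> real \<Rightarrow> real \<Rightarrow> real" where
  "weight \<alpha> \<gamma> \<kappa> x y =
     (x * y) powr \<alpha> * (1 - x - y) powr \<gamma> * \<bar>x - y\<bar> powr (2 * \<kappa> + 1)"

definition inner_w :: "real \<Rightarrow> real \<Rightarrow> real \<Rightarrow> poly2 \<Rightarrow> poly2 \<Rightarrow> real" where
  "inner_w \<alpha> \<gamma> \<kappa> P Q =
     (LINT (x, y):triangle|lborel. eval2 P x y * eval2 Q x y * weight \<alpha> \<gamma> \<kappa> x y)"

definition prec :: "nat \<times> nat \<Rightarrow> nat \<times> nat \<Rightarrow> bool" (infix \<open>\<prec>\<close> 50) where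
  "s \<prec> t \<longleftrightarrow>
     fst s + 2 * snd s < fst t + 2 * snd t \<or>
     fst s + 2 * snd s = fst t + 2 * snd t \<and> snd s < snd t"

definition symmetric2 :: "poly2 \<Rightarrow> bool" where
  "symmetric2 P \<longleftrightarrow> (\<forall>x y. eval2 P x y = eval2 P y x)"

definition sym_monom :: "nat \<times> nat \<Rightarrow> poly2" where
  "sym_monom s = (fst_var + snd_var) ^ fst s * (fst_var * snd_var) ^ snd s"

definition sym_comb :: "(nat \<times> nat \<Rightarrow> real) \<Rightarrow> poly2" where
  "sym_comb c = (\<Sum>s | c s \<noteq> 0. scale2 (c s) (sym_monom s))"

text \<open>
  The symmetric degree is a relation because the zero polynomial has none; elsewhere it is
  single-valued, since the \<open>sym_monom s\<close> are linearly independent.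
\<close>

definition has_sym_degree :: "poly2 \<Rightarrow> nat \<times> nat \<Rightarrow> bool" where
  "has_sym_degree P d \<longleftrightarrow>
     (\<exists>c. finite {s. c s \<noteq> 0} \<and> P = sym_comb c \<and> c d \<noteq> 0 \<and>
          (\<forall>s. c s \<noteq> 0 \<longrightarrow> s = d \<or> s \<prec> d))"

definition p_poly :: "real \<Rightarrow> real \<Rightarrow> real \<Rightarrow> nat \<Rightarrow> nat \<Rightarrow> poly2" where
  "p_poly \<alpha> \<gamma> \<kappa> n k = (THE P.
     symmetric2 P \<and>
     (\<exists>c. finite {s. c s \<noteq> 0} \<and> (\<forall>s. c s \<noteq> 0 \<longrightarrow> s \<prec> (n, k)) \<and>
          P = sym_monom (n, k) + sym_comb c) \<and>
     (\<forall>Q d. symmetric2 Q \<and> has_sym_degree Q d \<and> d \<prec> (n, k) \<longrightarrow> inner_w \<alpha> \<gamma> \<kappa> P Q = 0))"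

definition q_poly :: "real \<Rightarrow> real \<Rightarrow> real \<Rightarrow> nat \<Rightarrow> nat \<Rightarrow> poly2" where
  "q_poly \<alpha> \<gamma> \<kappa> n k = (THE Q.
     \<forall>x y. eval2 Q (x + y) (x * y) = eval2 (p_poly \<alpha> \<gamma> \<kappa> n k) x y)"

definition deriv_u :: "poly2 \<Rightarrow> poly2" where
  "deriv_u P = map_poly pderiv P"

definition deriv_v :: "poly2 \<Rightarrow> poly2" where
  "deriv_v P = pderiv P"

text \<open>
  A differential operator with polynomial coefficients is identified with its action on
  \<open>\<real>[u,v]\<close>. In characteristic zero this action determines all coefficients \<open>a r s\<close>.
\<close>

definition is_diff_op :: "(poly2 \<Rightarrow> poly2) \<Rightarrow> bool" where
  "is_diff_op D \<longleftrightarrow>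
     (\<exists>S a. finite (S :: (nat \<times> nat) set) \<and>
        D = (\<lambda>f. \<Sum>(r, s)\<in>S. a r s * (deriv_u ^^ r) ((deriv_v ^^ s) f)))"

definition diff_op_algebra :: "real \<Rightarrow> real \<Rightarrow> real \<Rightarrow> (poly2 \<Rightarrow> poly2) set" where
  "diff_op_algebra \<alpha> \<gamma> \<kappa> = {D. is_diff_op D \<and>
     (\<forall>n k. \<exists>\<Lambda>. D (q_poly \<alpha> \<gamma> \<kappa> n k) = scale2 \<Lambda> (q_poly \<alpha> \<gamma> \<kappa> n k))}"

text \<open>
  Isomorphism of unital real algebras from \<open>\<real>[X,Y]\<close> onto a set of operators, whose product
  is composition. That the set is closed under the operations follows from these clauses.
\<close>

definition is_algebra_iso :: "(poly2 \<Rightarrow> poly2 \<Rightarrow> poly2) \<Rightarrow> (poly2 \<Rightarrow> poly2) set \<Rightarrow> bool" where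
  "is_algebra_iso \<Phi> A \<longleftrightarrow>
     bij_betw \<Phi> UNIV A \<and>
     \<Phi> 1 = id \<and>
     (\<forall>P Q. \<Phi> (P + Q) = (\<lambda>f. \<Phi> P f + \<Phi> Q f)) \<and>
     (\<forall>P Q. \<Phi> (P * Q) = \<Phi> P \<circ> \<Phi> Q) \<and>
     (\<forall>c P. \<Phi> (scale2 c P) = (\<lambda>f. scale2 c (\<Phi> P f)))"

end

theory Submission
  imports Defs
begin

text \<open>
  In the coordinates \<open>u\<close> and \<open>z = 4 v / u\<^sup>2\<close> the weight is a product, so the moments of the
  monomials \<open>u\<^sup>i v\<^sup>j\<close> are products of beta integrals. The recurrences of these moments show that the
  Jacobi operator in \<open>z\<close> (\<open>angular_op\<close>, eigenvalue \<open>- k (k + a)\<close>) and an operator of Laplace type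
  (\<open>radial_op\<close>, eigenvalue \<open>- N (N + c)\<close> with \<open>N = n + 2 k\<close>) are self-adjoint; both have polynomial
  coefficients and are triangular for \<open>prec\<close>, hence are diagonal on the \<open>q_poly\<close>. The two eigenvalues are
  algebraically independent functions of \<open>(n, k)\<close>, which gives an embedding of the polynomial ring.

  It is onto by evaluation at the corner \<open>(u, v) = (1, 0)\<close>, where the singular
  curves \<open>v = 0\<close> and \<open>u = 1\<close> of the operators meet: there the eigenvalue equations \<open>angular_op f = \<mu> f\<close> and
  \<open>radial_op f = \<nu> f\<close> determine all partial derivatives of \<open>f\<close> recursively, as \<open>f(1, 0)\<close> times
  polynomials in \<open>\<mu>\<close> and \<open>\<nu>\<close>. Evaluating \<open>D f = \<Lambda> f\<close> at this point therefore exhibits the eigenvalue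
  \<open>\<Lambda>\<close> of any operator \<open>D\<close> of the algebra as a polynomial in \<open>\<mu>\<close> and \<open>\<nu>\<close>.
\<close>

subsection \<open>Polynomials in two variables\<close>

lemma scale2_simps:
  "scale2 c (P + Q) = scale2 c P + scale2 c Q"
  "scale2 (b + c) P = scale2 b P + scale2 c P"
  "scale2 b (scale2 c P) = scale2 (b * c) P"
  "scale2 1 P = P"
  by (simp_all add: scale2_def smult_add_right smult_add_left[symmetric] one_pCons[symmetric] mult.commute)

lemma scale2_mult: "scale2 r f * g = scale2 r (f * g)" "f * scale2 r g = scale2 r (f * g)"
  by (simp_all add: scale2_def)

interpretation poly2: vector_space scale2
  by unfold_locales (simp_all add: scale2_simps)

abbreviation linear_op :: "(poly2 \<Rightarrow> poly2) \<Rightarrow> bool" where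
  "linear_op \<equiv> module_hom scale2 scale2"

abbreviation linear_form :: "(poly2 \<Rightarrow> real) \<Rightarrow> bool" where
  "linear_form \<equiv> module_hom scale2 (*)"

lemma linear_opI:
  assumes "\<And>f g. D (f + g) = D f + D g" "\<And>c f. D (scale2 c f) = scale2 c (D f)"
  shows "linear_op D"
  using assms by unfold_locales

lemma linear_formI:
  assumes "\<And>f g. L (f + g) = L f + L g" "\<And>c f. L (scale2 c f) = c * L f"
  shows "linear_form L"
  using assms by unfold_locales (auto simp: algebra_simps)

lemma linear_op_compose: "linear_op D \<Longrightarrow> linear_op E \<Longrightarrow> linear_op (\<lambda>f. D (E f))"
  by (simp add: module_hom_iff)

lemma linear_op_funpow: "linear_op D \<Longrightarrow> linear_op (D ^^ i)"
  by (induction i) (simp_all add: module_hom_iff poly2.module_axioms)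

lemma linear_op_mult_left: "linear_op (\<lambda>f. a * f)"
  by (rule linear_opI) (simp_all add: algebra_simps scale2_def)

lemma linear_op_scale2: "linear_op (scale2 c)"
  by (rule linear_opI) (simp_all add: scale2_simps mult.commute)

lemma coeff_deriv_u: "coeff (deriv_u f) j = pderiv (coeff f j)"
  by (simp add: deriv_u_def coeff_map_poly)

lemma linear_op_deriv_u: "linear_op deriv_u"
  by (rule linear_opI)
    (simp_all add: poly_eq_iff coeff_deriv_u scale2_def pderiv_add pderiv_smult coeff_pderiv algebra_simps)

lemma linear_op_deriv_v: "linear_op deriv_v"
  by (rule linear_opI)
    (simp_all add: deriv_v_def scale2_def pderiv_add pderiv_smult)

lemma eval2_simps [simp]:
  "eval2 (P + Q) a b = eval2 P a b + eval2 Q a b"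
  "eval2 (P - Q) a b = eval2 P a b - eval2 Q a b"
  "eval2 (P * Q) a b = eval2 P a b * eval2 Q a b"
  "eval2 (scale2 c P) a b = c * eval2 P a b"
  "eval2 0 a b = 0"
  "eval2 1 a b = 1"
  "eval2 (P ^ n) a b = eval2 P a b ^ n"
  "eval2 fst_var a b = a"
  "eval2 snd_var a b = b"
  by (simp_all add: eval2_def scale2_def poly_power)

lemma eval2_sum [simp]: "eval2 (sum f A) a b = (\<Sum>x\<in>A. eval2 (f x) a b)"
  by (induction A rule: infinite_finite_induct) simp_all

text \<open>As a polynomial in the second variable over the domain R[u], a nonzero \<open>P\<close>
  has finitely many roots; here every constant \<open>[:b:]\<close> with b in \<open>B\<close> is
  one.\<close>

lemma eval2_eq_0_imp_eq_0:
  assumes "infinite B" "\<And>b. b \<in> B \<Longrightarrow> infinite {a. eval2 P a b = 0}"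
  shows "P = 0"
proof (rule ccontr)
  assume "P \<noteq> 0"
  have "poly P [:b:] = 0" if "b \<in> B" for b
    using assms(2)[OF that] poly_roots_finite[of "poly P [:b:]"] by (auto simp: eval2_def)
  then have "(\<lambda>b. [:b:]) ` B \<subseteq> {r. poly P r = 0}" by auto
  then have "finite ((\<lambda>b. [:b:]) ` B)"
    using poly_roots_finite[OF \<open>P \<noteq> 0\<close>] finite_subset by blast
  then show False using assms(1) by (simp add: finite_image_iff inj_on_def)
qed

text \<open>For b <= 0 the quadratic T^2 - a T + b has real roots, so every such point (a, b) has
  the form (x + y, x y).\<close>

lemma eval2_subst_eq_0_imp_eq_0:
  assumes "\<And>x y. eval2 P (x + y) (x * y) = 0"
  shows "P = 0"
proof (rule eval2_eq_0_imp_eq_0)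
  show "infinite {..(0::real)}" by (rule infinite_Iic)
next
  fix b :: real assume "b \<in> {..0}"
  have "eval2 P a b = 0" for a
  proof -
    define d where "d = sqrt (a\<^sup>2 - 4 * b)"
    have "4 * b \<le> a\<^sup>2"
      using \<open>b \<in> {..0}\<close> zero_le_power2[of a] unfolding atMost_iff by linarith
    then have "d\<^sup>2 = a\<^sup>2 - 4 * b" by (simp add: d_def)
    then have "(a + d) / 2 * ((a - d) / 2) = b" by (simp add: field_simps power2_eq_square)
    then show ?thesis using assms[of "(a + d) / 2" "(a - d) / 2"] by (simp add: field_simps)
  qed
  then show "infinite {a. eval2 P a b = 0}" by (simp add: infinite_UNIV_char_0)
qed

section \<open>Coefficients and the monomial basis\<close>

definition coeff2 :: "poly2 \<Rightarrow> nat \<times> nat \<Rightarrow> real" where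
  "coeff2 f s = coeff (coeff f (snd s)) (fst s)"

definition monom2 :: "nat \<times> nat \<Rightarrow> poly2" where
  "monom2 s = monom (monom 1 (fst s)) (snd s)"

lemma coeff2_simps [simp]:
  "coeff2 (f + g) s = coeff2 f s + coeff2 g s"
  "coeff2 (f - g) s = coeff2 f s - coeff2 g s"
  "coeff2 (scale2 c f) s = c * coeff2 f s"
  "coeff2 0 s = 0"
  by (simp_all add: coeff2_def scale2_def)

lemma coeff2_monom2: "coeff2 (monom2 s) t = (if s = t then 1 else 0)"
  by (auto simp: coeff2_def monom2_def prod_eq_iff)

lemma coeff2_eqI: "(\<And>s. coeff2 f s = coeff2 g s) \<Longrightarrow> f = g"
  by (auto simp: coeff2_def poly_eq_iff)

lemma coeff2_sum: "coeff2 (sum f A) s = (\<Sum>x\<in>A. coeff2 (f x) s)"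
  by (induction A rule: infinite_finite_induct) simp_all

lemma finite_coeff2: "finite {s. coeff2 f s \<noteq> 0}"
proof (rule finite_subset)
  show "{s. coeff2 f s \<noteq> 0} \<subseteq> (\<Union>j\<in>{..degree f}. (\<lambda>i. (i, j)) ` {..degree (coeff f j)})"
    by (auto simp: coeff2_def image_iff intro!: le_degree)
qed auto

lemma coeff2_sum_monom2:
  assumes "finite {s. c s \<noteq> 0}"
  shows "coeff2 (\<Sum>s | c s \<noteq> 0. scale2 (c s) (monom2 s)) t = c t"
  using assms by (simp add: coeff2_sum coeff2_monom2 if_distrib sum.delta cong: if_cong)

lemma poly2_as_sum: "(\<Sum>s | coeff2 f s \<noteq> 0. scale2 (coeff2 f s) (monom2 s)) = f"
  by (rule coeff2_eqI) (simp add: coeff2_sum_monom2 finite_coeff2)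

lemma coeff2_span_monom2:
  "f \<in> poly2.span (monom2 ` A) \<longleftrightarrow> (\<forall>s. coeff2 f s \<noteq> 0 \<longrightarrow> s \<in> A)"
proof
  assume "f \<in> poly2.span (monom2 ` A)"
  then show "\<forall>s. coeff2 f s \<noteq> 0 \<longrightarrow> s \<in> A"
    by (induction rule: poly2.span_induct_alt) (auto simp: coeff2_monom2 split: if_splits)
next
  assume "\<forall>s. coeff2 f s \<noteq> 0 \<longrightarrow> s \<in> A"
  then have "(\<Sum>s | coeff2 f s \<noteq> 0. scale2 (coeff2 f s) (monom2 s)) \<in> poly2.span (monom2 ` A)"
    by (intro poly2.span_sum poly2.span_scale poly2.span_base) auto
  then show "f \<in> poly2.span (monom2 ` A)" by (simp add: poly2_as_sum)
qed

lemma span_range_monom2: "poly2.span (range monom2) = UNIV"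
  using coeff2_span_monom2[of _ UNIV] by auto

lemma eval2_monom2 [simp]: "eval2 (monom2 s) a b = a ^ fst s * b ^ snd s"
  by (simp add: eval2_def monom2_def poly_monom poly_power mult.commute)

lemma monom2_mult: "monom2 (i, j) * monom2 (k, l) = monom2 (i + k, j + l)"
  by (simp add: monom2_def mult_monom)

section \<open>The substitution u = x + y, v = x y\<close>

definition sym_subst :: "poly2 \<Rightarrow> poly2" where
  "sym_subst f = sym_comb (coeff2 f)"

lemma eval2_sym_monom: "eval2 (sym_monom s) x y = (x + y) ^ fst s * (x * y) ^ snd s"
  by (simp only: sym_monom_def eval2_simps)

lemma eval2_sym_comb:
  "eval2 (sym_comb c) x y = eval2 (\<Sum>s | c s \<noteq> 0. scale2 (c s) (monom2 s)) (x + y) (x * y)"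
  by (simp add: sym_comb_def eval2_sym_monom)

lemma eval2_sym_subst [simp]: "eval2 (sym_subst f) x y = eval2 f (x + y) (x * y)"
  by (simp only: sym_subst_def eval2_sym_comb poly2_as_sum)

lemma eval2_eqI:
  assumes "\<And>x y. eval2 P x y = eval2 Q x y"
  shows "P = Q"
  using eval2_subst_eq_0_imp_eq_0[of "P - Q"] assms by simp

lemma sym_subst_simps:
  "sym_subst 0 = 0"
  "sym_subst (f + g) = sym_subst f + sym_subst g"
  "sym_subst (monom2 s) = sym_monom s"
  by (rule eval2_eqI; simp add: eval2_sym_monom)+

lemma sym_comb_eq_sym_subst:
  assumes "finite {s. c s \<noteq> 0}"
  obtains f where "sym_comb c = sym_subst f" "coeff2 f = c"
proof
  let ?f = "\<Sum>s | c s \<noteq> 0. scale2 (c s) (monom2 s)"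
  show "sym_comb c = sym_subst ?f" by (rule eval2_eqI) (simp only: eval2_sym_comb eval2_sym_subst)
  show "coeff2 ?f = c" using coeff2_sum_monom2[OF assms] by auto
qed

lemma sym_subst_inj: "sym_subst f = sym_subst g \<Longrightarrow> f = g"
  using eval2_subst_eq_0_imp_eq_0[of "f - g"] eval2_sym_subst by (metis eval2_simps(2) eq_iff_diff_eq_0)

lemma symmetric2_sym_subst: "symmetric2 (sym_subst f)"
  by (simp add: symmetric2_def add.commute mult.commute)

subsection \<open>Moments of the weight\<close>

lemma nn_integral_powr_Icc:
  fixes a b :: real
  assumes "a > -1" "b > -1"
  shows "(\<integral>\<^sup>+x. ennreal (x powr a * (1 - x) powr b) * indicator {0..1} x \<partial>lborel) =
    ennreal (Beta (a + 1) (b + 1))"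
proof -
  have "((\<lambda>t. t powr a * (1 - t) powr b) has_integral Beta (a + 1) (b + 1)) {0..1}"
    using has_integral_Beta_real[of "a + 1" "b + 1"] assms by simp
  then have "((\<lambda>t. t powr a * (1 - t) powr b * indicator {0..1} t) has_integral Beta (a + 1) (b + 1)) UNIV"
    by (subst (asm) has_integral_restrict_UNIV[symmetric])
      (simp add: indicator_def of_bool_def if_distrib cong: if_cong)
  then have "(\<integral>\<^sup>+x. ennreal (x powr a * (1 - x) powr b * indicator {0..1} x) \<partial>lborel) =
    ennreal (Beta (a + 1) (b + 1))"
    by (intro nn_integral_has_integral_lborel) auto
  then show ?thesis by (simp add: ennreal_mult'' ennreal_indicator)
qed

text \<open>Half a beta integral, by x = s^2: the factor s in dx = 2 s ds turns (s^2)^k into s^(2 k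
  + 1).\<close>

lemma nn_integral_powr_square:
  fixes k b :: real
  assumes "k > -1" "b > -1"
  shows "(\<integral>\<^sup>+s. ennreal (s powr (2 * k + 1) * (1 - s\<^sup>2) powr b) * indicator {0..1} s \<partial>lborel) =
    ennreal (Beta (k + 1) (b + 1) / 2)"
proof -
  have "ennreal (Beta (k + 1) (b + 1)) =
      (\<integral>\<^sup>+x. ennreal (x powr k * (1 - x) powr b * indicator {0\<^sup>2..1\<^sup>2} x) \<partial>lborel)"
    using nn_integral_powr_Icc[OF assms] by (simp add: ennreal_mult'' ennreal_indicator)
  also have "\<dots> = (\<integral>\<^sup>+s. ennreal ((s\<^sup>2) powr k * (1 - s\<^sup>2) powr b * (2 * s) * indicator {0..1} s) \<partial>lborel)"
    by (rule nn_integral_substitution[where g = "\<lambda>s. s\<^sup>2" and g' = "\<lambda>s. 2 * s" and a = 0 and b = 1])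
      (auto intro!: derivative_eq_intros continuous_intros simp: set_borel_measurable_def)
  also have "\<dots> = (\<integral>\<^sup>+s. ennreal 2 * (ennreal (s powr (2 * k + 1) * (1 - s\<^sup>2) powr b) * indicator {0..1} s) \<partial>lborel)"
  proof (intro nn_integral_cong)
    fix s :: real
    have eq: "s\<^sup>2 powr k * (1 - s\<^sup>2) powr b * (2 * s) = 2 * (s powr (2 * k + 1) * (1 - s\<^sup>2) powr b)"
      if "0 \<le> s"
    proof (cases "s = 0")
      case False
      then have "s\<^sup>2 powr k * s = s powr (2 * k + 1)"
        using that by (simp add: powr_add powr_powr flip: powr_numeral)
      then show ?thesis by (simp add: ac_simps)
    qed simp
    show "ennreal (s\<^sup>2 powr k * (1 - s\<^sup>2) powr b * (2 * s) * indicator {0..1} s) =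
       ennreal 2 * (ennreal (s powr (2 * k + 1) * (1 - s\<^sup>2) powr b) * indicator {0..1} s)"
    proof (cases "s \<in> {0..1}")
      case True
      then have "0 \<le> s" by simp
      with True show ?thesis by (simp only: eq indicator_simps mult_1_right) (simp add: ennreal_mult'[of 2])
    qed simp
  qed
  also have "\<dots> = ennreal 2 *
      (\<integral>\<^sup>+s. ennreal (s powr (2 * k + 1) * (1 - s\<^sup>2) powr b) * indicator {0..1} s \<partial>lborel)"
    by (intro nn_integral_cmult) measurable
  finally have eq: "ennreal (Beta (k + 1) (b + 1)) = ennreal 2 *
      (\<integral>\<^sup>+s. ennreal (s powr (2 * k + 1) * (1 - s\<^sup>2) powr b) * indicator {0..1} s \<partial>lborel)" (is "_ = _ * ?I") .
  have "?I = ennreal (1/2) * (ennreal 2 * ?I)"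
    by (simp flip: mult.assoc ennreal_mult' del: ennreal_numeral ennreal_half)
  also have "\<dots> = ennreal (Beta (k + 1) (b + 1) / 2)"
    unfolding eq[symmetric] by (subst ennreal_mult''[symmetric]) (use assms in \<open>auto simp: Beta_def Gamma_real_pos less_imp_le\<close>)
  finally show ?thesis .
qed

lemma Beta_real_pos: "a > 0 \<Longrightarrow> b > 0 \<Longrightarrow> Beta a b > (0::real)"
  by (simp add: Beta_def Gamma_real_pos)

lemma pos_notin_nonpos_Ints: "x > 0 \<Longrightarrow> x \<notin> \<int>\<^sub>\<le>\<^sub>0" for x :: real
  by (auto elim!: nonpos_Ints_cases)

section \<open>Radial and angular moments\<close>

locale koornwinder =
  fixes \<alpha> \<gamma> \<kappa> :: real
  assumes \<alpha>: "\<alpha> > -1" and \<gamma>: "\<gamma> > -1" and \<kappa>: "\<kappa> > -1" and \<alpha>\<kappa>: "\<alpha> + \<kappa> > -3/2"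
begin

text \<open>In the coordinates u and z = 4 v / u^2 the measure is a constant times u^(2 a) (1 -
  u)^\<gamma> z^\<alpha> (1 - z)^\<kappa> du dz. Both \<open>a\<close> and \<open>c\<close> are a
  sum of two exponents plus one, the shift in the Jacobi eigenvalue - n (n + shift).\<close>

definition a :: real where "a = \<alpha> + \<kappa> + 1"
definition c :: real where "c = 2 * a + \<gamma> + 1"

text \<open>Here \<open>\<alpha> + \<kappa> > -3/2\<close> enters: 2 a > -1 makes u^(2 a) integrable
  at 0.\<close>

lemma a_gt: "a > -1/2" and c_gt: "c > -1"
  using \<alpha>\<kappa> \<gamma> by (simp_all add: a_def c_def)

text \<open>Since v = u^2 z / 4, the moment of u^i v^j splits into a radial factor with t = i + 2 j
  and an angular factor that depends on j only.\<close>

definition radial_moment :: "nat \<Rightarrow> real" where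
  "radial_moment t = Beta (real t + 2 * a + 1) (\<gamma> + 1)"

definition angular_moment :: "nat \<Rightarrow> real" where
  "angular_moment j = (1/4) powr (real j + \<alpha>) / 4 * Beta (\<kappa> + 1) (real j + \<alpha> + 1)"

lemma moments_pos: "radial_moment t > 0" "angular_moment j > 0"
  using a_gt \<alpha> \<gamma> \<kappa> by (auto simp: radial_moment_def angular_moment_def Beta_real_pos)

lemma radial_moment_Suc:
  "(real t + 1 + c) * radial_moment (Suc t) = (real t + 1 + 2 * a) * radial_moment t"
  using Beta_plus1_left[OF pos_notin_nonpos_Ints, of "real t + 2 * a + 1" "\<gamma> + 1"] a_gt
  by (simp add: radial_moment_def c_def algebra_simps)

lemma angular_moment_Suc:
  "4 * (real j + 1 + a) * angular_moment (Suc j) = (real j + 1 + \<alpha>) * angular_moment j"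
proof -
  let ?b = "real j + \<alpha>"
  have *: "angular_moment (Suc j) = (1/4) powr (?b + 1) / 4 * Beta (\<kappa> + 1) (?b + 1 + 1)"
    by (simp add: angular_moment_def algebra_simps)
  have **: "(1/4) powr (?b + 1) = (1/4) powr ?b * (1/4)" by (simp only: powr_add) simp
  have "4 * (real j + 1 + a) * angular_moment (Suc j) =
      (1/4) powr ?b / 4 * ((\<kappa> + 1 + (?b + 1)) * Beta (\<kappa> + 1) (?b + 1 + 1))"
    unfolding * ** by (simp add: a_def field_simps)
  also have "\<dots> = (real j + 1 + \<alpha>) * angular_moment j"
    using \<alpha> by (subst Beta_plus1_right[OF pos_notin_nonpos_Ints]) (simp_all add: angular_moment_def algebra_simps)
  finally show ?thesis .
qed

text \<open>
  The substitution is \<open>x = u (1 + s) / 2\<close>, \<open>y = u (1 - s) / 2\<close>, done as a shift in \<open>y\<close> followed by a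
  dilation in \<open>x\<close>; then \<open>4 v / u\<^sup>2 = 1 - s\<^sup>2\<close>.
\<close>

lemma nn_integral_monomial:
  "(\<integral>\<^sup>+z. ennreal (indicator triangle z *
      (case z of (x, y) \<Rightarrow> (x + y) ^ i * (x * y) ^ j * weight \<alpha> \<gamma> \<kappa> x y)) \<partial>lborel) =
    ennreal (radial_moment (i + 2 * j) * angular_moment j)"
proof -
  \<comment> \<open>Extension of the integrand by zero outside \<open>triangle\<close>; 0 <= x
    follows from 0 <= y < x.\<close>
  define F where "F x y = (if 0 \<le> y \<and> x + y \<le> 1 \<and> y < x
    then (x + y) ^ i * (x * y) ^ j * weight \<alpha> \<gamma> \<kappa> x y else 0)" for x y :: real
  have [measurable]: "(\<lambda>z. F (g z) (h z)) \<in> borel_measurable M"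
    if [measurable]: "g \<in> borel_measurable M" "h \<in> borel_measurable M" for g h and M :: "'m measure"
    unfolding F_def weight_def by measurable
  have F_nonneg: "F x y \<ge> 0" for x y by (simp add: F_def weight_def)
  \<comment> \<open>The Jacobian u / 2 is split: u goes into \<open>G\<close> and 1/2 into
    \<open>H\<close>.\<close>
  define G where "G u = u powr (real (i + 2 * j) + 2 * a) * (1 - u) powr \<gamma>" for u :: real
  define H where "H s = (1/4) powr (real j + \<alpha>) / 2 * (s powr (2 * \<kappa> + 1) * (1 - s\<^sup>2) powr (real j + \<alpha>))" for s :: real
  have [measurable]: "G \<in> borel_measurable borel" "H \<in> borel_measurable borel"
    unfolding G_def H_def by measurable
  have polar: "F (u / 2 + u / 2 * s) (u / 2 - u / 2 * s) * (u / 2) = G u * H s"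
    if "0 < u" "u \<le> 1" "0 < s" "s < 1" for u s
  proof -
    have xy: "(u / 2 + u / 2 * s) * (u / 2 - u / 2 * s) = u\<^sup>2 * (1 - s\<^sup>2) / 4"
      by (simp add: field_simps power2_eq_square)
    have pos: "1 - s\<^sup>2 > 0" using that by (simp add: power_less_one_iff abs_square_less_1)
    have "u / 2 * s < u / 2" using that by simp
    then have "F (u / 2 + u / 2 * s) (u / 2 - u / 2 * s) =
      u ^ i * (u\<^sup>2 * (1 - s\<^sup>2) / 4) ^ j * ((u\<^sup>2 * (1 - s\<^sup>2) / 4) powr \<alpha> * (1 - u) powr \<gamma> * (u * s) powr (2 * \<kappa> + 1))"
      unfolding F_def weight_def xy using that by (simp add: algebra_simps abs_mult)
    also have "\<dots> = u powr i * (u\<^sup>2 * (1 - s\<^sup>2) / 4) powr (real j + \<alpha>) * (1 - u) powr \<gamma> * (u * s) powr (2 * \<kappa> + 1)"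
      using that pos by (simp add: powr_add powr_realpow)
    also have "\<dots> = u powr i * (u powr (2 * (real j + \<alpha>)) * (1 - s\<^sup>2) powr (real j + \<alpha>) * (1/4) powr (real j + \<alpha>)) *
        (1 - u) powr \<gamma> * (u powr (2 * \<kappa> + 1) * s powr (2 * \<kappa> + 1))"
    proof -
      have "u\<^sup>2 powr (real j + \<alpha>) = u powr (2 * (real j + \<alpha>))"
        using that by (simp add: powr_powr flip: powr_numeral)
      moreover have "(u\<^sup>2 * (1 - s\<^sup>2) / 4) = u\<^sup>2 * (1 - s\<^sup>2) * (1/4)" by simp
      ultimately show ?thesis using that pos by (simp only: powr_mult)
    qed
    finally have "F (u / 2 + u / 2 * s) (u / 2 - u / 2 * s) * (u / 2) =
       (u powr i * u powr (2 * (real j + \<alpha>)) * u powr (2 * \<kappa> + 1) * u powr 1) * (1 - u) powr \<gamma> * H s"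
      using that by (simp add: H_def)
    also have "u powr i * u powr (2 * (real j + \<alpha>)) * u powr (2 * \<kappa> + 1) * u powr 1 = u powr (real (i + 2 * j) + 2 * a)"
      unfolding powr_add[symmetric] by (rule arg_cong[where f = "(powr) u"]) (simp add: a_def algebra_simps)
    finally show ?thesis by (simp add: G_def)
  qed
  have inner: "(\<integral>\<^sup>+x. ennreal (F x (u - x)) \<partial>lborel) =
      (\<integral>\<^sup>+s. ennreal (G u) * indicator {0..1} u * (ennreal (H s) * indicator {0..1} s) \<partial>lborel)" if "u \<noteq> 1" for u
  proof (cases "0 < u \<and> u \<le> 1")
    case True
    have "(\<integral>\<^sup>+x. ennreal (F x (u - x)) \<partial>lborel) =
        ennreal (u / 2) * (\<integral>\<^sup>+s. ennreal (F (u / 2 + u / 2 * s) (u / 2 - u / 2 * s)) \<partial>lborel)"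
      using True by (subst nn_integral_real_affine[where c = "u / 2" and t = "u / 2"]) (auto simp: algebra_simps)
    also have "\<dots> = (\<integral>\<^sup>+s. ennreal (F (u / 2 + u / 2 * s) (u / 2 - u / 2 * s) * (u / 2)) \<partial>lborel)"
      by (subst nn_integral_cmult[symmetric])
        (simp_all only: ennreal_mult''[OF F_nonneg, symmetric] mult.commute, measurable)
    also have "\<dots> = (\<integral>\<^sup>+s. ennreal (G u) * indicator {0..1} u * (ennreal (H s) * indicator {0..1} s) \<partial>lborel)"
    proof (rule nn_integral_cong_AE)
      have "AE s in lborel. s \<noteq> 0 \<and> s \<noteq> (1::real)" by (intro AE_conjI AE_lborel_singleton)
      then show "AE s in lborel. ennreal (F (u / 2 + u / 2 * s) (u / 2 - u / 2 * s) * (u / 2)) =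
          ennreal (G u) * indicator {0..1} u * (ennreal (H s) * indicator {0..1} s)"
      proof eventually_elim
        fix s :: real assume s: "s \<noteq> 0 \<and> s \<noteq> 1"
        show "ennreal (F (u / 2 + u / 2 * s) (u / 2 - u / 2 * s) * (u / 2)) =
          ennreal (G u) * indicator {0..1} u * (ennreal (H s) * indicator {0..1} s)"
        proof (cases "0 < s \<and> s < 1")
          case s': True
          then show ?thesis using polar[of u s] True by (simp add: ennreal_mult' G_def)
        next
          case False
          then have "F (u / 2 + u / 2 * s) (u / 2 - u / 2 * s) = 0"
            using s True by (auto simp: F_def not_less zero_less_mult_iff)
          then show ?thesis using False s by (auto simp: indicator_def)
        qed
      qed
    qed
    finally show ?thesis .
  next
    case False
    then have "F x (u - x) = 0" for x by (auto simp: F_def)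
    \<comment> \<open>At u = 0 the convention that \<open>0 powr r\<close> is 0 makes
      \<open>G\<close> vanish.\<close>
    moreover have "ennreal (G u) * indicator {0..1} u = 0"
      using False by (cases "u = 0") (auto simp: G_def indicator_def)
    ultimately show ?thesis by (simp only: mult_zero_left) simp
  qed
  have "(\<integral>\<^sup>+z. ennreal (indicator triangle z *
      (case z of (x, y) \<Rightarrow> (x + y) ^ i * (x * y) ^ j * weight \<alpha> \<gamma> \<kappa> x y)) \<partial>lborel) =
    (\<integral>\<^sup>+z. ennreal (F (fst z) (snd z)) \<partial>(lborel \<Otimes>\<^sub>M lborel))"
    unfolding lborel_prod by (intro nn_integral_cong) (auto simp: F_def triangle_def indicator_def)
  also have "\<dots> = (\<integral>\<^sup>+x. (\<integral>\<^sup>+y. ennreal (F x y) \<partial>lborel) \<partial>lborel)"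
    by (subst lborel.nn_integral_fst[symmetric]) auto
  also have "\<dots> = (\<integral>\<^sup>+x. (\<integral>\<^sup>+u. ennreal (F x (u - x)) \<partial>lborel) \<partial>lborel)"
  proof (rule nn_integral_cong)
    fix x :: real
    show "(\<integral>\<^sup>+y. ennreal (F x y) \<partial>lborel) = (\<integral>\<^sup>+u. ennreal (F x (u - x)) \<partial>lborel)"
      by (subst nn_integral_real_affine[where c = 1 and t = "- x"]) auto
  qed
  also have "\<dots> = (\<integral>\<^sup>+u. (\<integral>\<^sup>+x. ennreal (F x (u - x)) \<partial>lborel) \<partial>lborel)"
    by (rule lborel_pair.Fubini') auto
  also have "\<dots> = (\<integral>\<^sup>+u. (\<integral>\<^sup>+s. ennreal (G u) * indicator {0..1} u * (ennreal (H s) * indicator {0..1} s) \<partial>lborel) \<partial>lborel)"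
    by (rule nn_integral_cong_AE) (use AE_lborel_singleton[of 1] inner in auto)
  also have "\<dots> = (\<integral>\<^sup>+u. ennreal (G u) * indicator {0..1} u \<partial>lborel) * (\<integral>\<^sup>+s. ennreal (H s) * indicator {0..1} s \<partial>lborel)"
    by (simp add: nn_integral_cmult nn_integral_multc)
  also have "(\<integral>\<^sup>+u. ennreal (G u) * indicator {0..1} u \<partial>lborel) = ennreal (radial_moment (i + 2 * j))"
    unfolding G_def radial_moment_def using a_gt \<gamma> by (subst nn_integral_powr_Icc) (auto simp: algebra_simps)
  also have "(\<integral>\<^sup>+s. ennreal (H s) * indicator {0..1} s \<partial>lborel) =
     ennreal ((1/4) powr (real j + \<alpha>) / 2) *
     (\<integral>\<^sup>+s. ennreal (s powr (2 * \<kappa> + 1) * (1 - s\<^sup>2) powr (real j + \<alpha>)) * indicator {0..1} s \<partial>lborel)"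
  proof (subst nn_integral_cmult[symmetric])
    have "ennreal (H s) = ennreal ((1/4) powr (real j + \<alpha>) / 2) *
        ennreal (s powr (2 * \<kappa> + 1) * (1 - s\<^sup>2) powr (real j + \<alpha>))" for s
      unfolding H_def by (rule ennreal_mult') simp
    then show "(\<integral>\<^sup>+s. ennreal (H s) * indicator {0..1} s \<partial>lborel) =
      (\<integral>\<^sup>+s. ennreal ((1/4) powr (real j + \<alpha>) / 2) *
        (ennreal (s powr (2 * \<kappa> + 1) * (1 - s\<^sup>2) powr (real j + \<alpha>)) * indicator {0..1} s) \<partial>lborel)"
      by (simp only: mult.assoc)
  qed measurable
  also have "\<dots> = ennreal (angular_moment j)"
    using \<alpha> \<kappa> by (subst nn_integral_powr_square) (auto simp: angular_moment_def simp flip: ennreal_mult')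
  finally show ?thesis
    using moments_pos by (simp add: ennreal_mult less_imp_le)
qed


section \<open>The moment functional and its positivity\<close>

definition L :: "poly2 \<Rightarrow> real" where
  "L f = (LINT (x, y):triangle|lborel. eval2 f (x + y) (x * y) * weight \<alpha> \<gamma> \<kappa> x y)"

lemma measurable_triangle [measurable]: "triangle \<in> sets borel"
proof -
  have "triangle = {z. 0 \<le> fst z \<and> 0 \<le> snd z \<and> fst z + snd z \<le> 1 \<and> snd z < fst z}"
    by (auto simp: triangle_def)
  also have "\<dots> \<in> sets borel"
    by (intro pred_Collect_borel, unfold borel_prod[symmetric]) measurable
  finally show ?thesis .
qed

lemma measurable_eval2 [measurable]:
  assumes [measurable]: "g \<in> borel_measurable M" "h \<in> borel_measurable M"
  shows "(\<lambda>z. eval2 f (g z) (h z)) \<in> borel_measurable M"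
proof -
  have "(\<lambda>z. eval2 f (g z) (h z)) =
      (\<lambda>z. \<Sum>s | coeff2 f s \<noteq> 0. coeff2 f s * (g z ^ fst s * h z ^ snd s))"
    by (subst poly2_as_sum[symmetric]) simp
  then show ?thesis by simp
qed

lemma measurable_weight [measurable]:
  "(\<lambda>z. weight \<alpha> \<gamma> \<kappa> (fst z) (snd z)) \<in> borel_measurable borel"
  unfolding weight_def borel_prod[symmetric] by measurable

lemma measurable_eval2_sum_prod [measurable]:
  "(\<lambda>z. eval2 f (fst z + snd z) (fst z * snd z)) \<in> borel_measurable borel"
  unfolding borel_prod[symmetric] by measurable

text \<open>The integrand is nonnegative on \<open>triangle\<close>, so its nonnegative integral
  gives integrability and the value at once.\<close>

lemma has_bochner_integral_monom2:
  "has_bochner_integral lborel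
     (\<lambda>z. indicator triangle z *\<^sub>R (case z of (x, y) \<Rightarrow> eval2 (monom2 s) (x + y) (x * y) * weight \<alpha> \<gamma> \<kappa> x y))
     (radial_moment (fst s + 2 * snd s) * angular_moment (snd s))"
proof (rule has_bochner_integral_nn_integral)
  show "(\<integral>\<^sup>+z. ennreal (indicator triangle z *\<^sub>R
      (case z of (x, y) \<Rightarrow> eval2 (monom2 s) (x + y) (x * y) * weight \<alpha> \<gamma> \<kappa> x y)) \<partial>lborel) =
    ennreal (radial_moment (fst s + 2 * snd s) * angular_moment (snd s))"
    using nn_integral_monomial[of "fst s" "snd s"] by simp
  show "(\<lambda>z. indicator triangle z *\<^sub>R
      (case z of (x, y) \<Rightarrow> eval2 (monom2 s) (x + y) (x * y) * weight \<alpha> \<gamma> \<kappa> x y)) \<in> borel_measurable lborel"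
    by (simp add: case_prod_beta del: eval2_monom2)
  show "AE z in lborel. 0 \<le> indicator triangle z *\<^sub>R
      (case z of (x, y) \<Rightarrow> eval2 (monom2 s) (x + y) (x * y) * weight \<alpha> \<gamma> \<kappa> x y)"
    by (auto simp: indicator_def triangle_def weight_def)
qed (use moments_pos in \<open>simp add: less_imp_le\<close>)

lemma integrable_poly2:
  "set_integrable lborel triangle (\<lambda>(x, y). eval2 f (x + y) (x * y) * weight \<alpha> \<gamma> \<kappa> x y)"
proof -
  have "f \<in> poly2.span (range monom2)" by (simp add: span_range_monom2)
  then show ?thesis
  proof (induction rule: poly2.span_induct_alt)
    case base
    then show ?case by (simp add: set_integrable_def case_prod_beta)
  next
    case (step r g h)
    then obtain s where "g = monom2 s" by auto
    then have "integrable lborel (\<lambda>z. r * (indicator triangle z *\<^sub>R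
        (case z of (x, y) \<Rightarrow> eval2 g (x + y) (x * y) * weight \<alpha> \<gamma> \<kappa> x y)))"
      using has_bochner_integral_monom2[of s] by (simp add: has_bochner_integral_iff del: eval2_monom2)
    from Bochner_Integration.integrable_add[OF this step(2)[unfolded set_integrable_def]]
    show ?case unfolding set_integrable_def
      by (rule Bochner_Integration.integrable_cong[THEN iffD1, rotated 2]) (auto simp: algebra_simps)
  qed
qed

lemma L_monom2: "L (monom2 (i, j)) = radial_moment (i + 2 * j) * angular_moment j"
  using has_bochner_integral_monom2[of "(i, j)"]
  unfolding L_def set_lebesgue_integral_def by (simp add: has_bochner_integral_iff)

lemma linear_form_L: "linear_form L"
proof (rule linear_formI)
  fix f g
  show "L (f + g) = L f + L g"
    unfolding L_def set_integral_add(2)[OF integrable_poly2 integrable_poly2, symmetric]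
    by (simp add: case_prod_unfold algebra_simps)
next
  fix r f
  show "L (scale2 r f) = r * L f"
    unfolding L_def set_integral_mult_right[symmetric] by (simp add: case_prod_unfold algebra_simps)
qed

lemma inner_w_sym_subst: "inner_w \<alpha> \<gamma> \<kappa> (sym_subst f) (sym_subst g) = L (f * g)"
  by (simp add: inner_w_def L_def)

text \<open>A nonnegative integrand with integral 0 vanishes almost everywhere; by continuity, a
  nonzero value of \<open>f\<close> at an interior point would persist on an open set, which is not
  negligible.\<close>

lemma L_square_eq_0:
  assumes "L (f * f) = 0"
  shows "f = 0"
proof -
  let ?F = "\<lambda>z. indicator triangle z *\<^sub>R
    (case z of (x, y) \<Rightarrow> eval2 (f * f) (x + y) (x * y) * weight \<alpha> \<gamma> \<kappa> x y)"
  have "AE z in lborel. ?F z = 0"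
  proof (subst integral_nonneg_eq_0_iff_AE[symmetric])
    show "integrable lborel ?F" using integrable_poly2[of "f * f"] by (simp add: set_integrable_def)
    show "AE z in lborel. 0 \<le> ?F z"
      by (auto simp: indicator_def weight_def)
    show "(LINT z|lborel. ?F z) = 0"
      using assms by (simp add: L_def set_lebesgue_integral_def)
  qed
  then have ae: "AE z in lborel. z \<notin> {z. ?F z \<noteq> 0}" by simp
  have "{z. ?F z \<noteq> 0} \<in> sets lborel" by measurable
  then have "{z. ?F z \<noteq> 0} \<in> null_sets lborel" using ae by (simp add: AE_iff_null_sets)
  then have negl: "negligible {z. ?F z \<noteq> 0}"
    by (simp add: negligible_iff_null_sets null_sets_completionI)
  let ?p = "\<lambda>z :: real \<times> real. eval2 f (fst z + snd z) (fst z * snd z)"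
  have cont: "continuous_on UNIV ?p"
    by (subst poly2_as_sum[symmetric]) (simp, intro continuous_intros)
  \<comment> \<open>The weight is strictly positive on this open part of the triangle.\<close>
  define U where "U = {z :: real \<times> real. 0 < snd z \<and> snd z < fst z \<and> fst z + snd z < 1 \<and> ?p z \<noteq> 0}"
  have "open U" unfolding U_def
    by (intro open_Collect_conj open_Collect_less open_Collect_neq continuous_intros cont)
  moreover have "U \<subseteq> {z. ?F z \<noteq> 0}"
    by (auto simp: U_def triangle_def weight_def)
  ultimately have "U = {}"
    using negl negligible_subset open_not_negligible by blast
  then have zero: "eval2 (sym_subst f) x y = 0" if "0 < y" "y < x" "x + y < 1" for x y
    using that unfolding U_def by (auto simp: set_eq_iff)
  have "sym_subst f = 0"
  \<comment> \<open>For 0 < y < 1/4 the segment 1/4 < x < 1/2 lies inside the triangle, which gives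
    infinitely many zeros on infinitely many lines.\<close>
  proof (rule eval2_eq_0_imp_eq_0[of "{0<..<1/4}"])
    fix y :: real assume "y \<in> {0<..<1/4}"
    then have "{1/4<..<1/2} \<subseteq> {x. eval2 (sym_subst f) x y = 0}" using zero by auto
    then show "infinite {x. eval2 (sym_subst f) x y = 0}" by (rule infinite_super) simp
  qed simp
  then show ?thesis using sym_subst_inj[of f 0] sym_subst_simps(1) by simp
qed

end

subsection \<open>Orthogonal polynomials and self-adjoint operators\<close>

lemma prec_trans: "prec s t \<Longrightarrow> prec t r \<Longrightarrow> prec s r"
  by (auto simp: prec_def)

lemma finite_prec: "finite {s. prec s d}"
proof (rule finite_subset)
  show "{s. prec s d} \<subseteq> {..fst d + 2 * snd d} \<times> {..fst d + 2 * snd d}"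
    by (auto simp: prec_def)
qed simp

lemma wf_prec: "wf {(s, t). prec s t}"
proof (rule wf_subset)
  show "{(s, t). prec s t} \<subseteq> inv_image (less_than <*lex*> less_than) (\<lambda>s. (fst s + 2 * snd s, snd s))"
    by (auto simp: prec_def)
qed auto

definition lower :: "nat \<times> nat \<Rightarrow> poly2 set" where
  "lower d = poly2.span (monom2 ` {s. prec s d})"

lemma subspace_lower: "poly2.subspace (lower d)"
  by (simp add: lower_def)

lemma monom2_in_lower: "prec s d \<Longrightarrow> monom2 s \<in> lower d"
  by (auto simp: lower_def intro: poly2.span_base)

lemma lower_mono: "prec s d \<Longrightarrow> lower s \<subseteq> lower d"
  unfolding lower_def by (intro poly2.span_mono) (auto intro: prec_trans)

lemma lower_iff: "f \<in> lower d \<longleftrightarrow> (\<forall>s. coeff2 f s \<noteq> 0 \<longrightarrow> prec s d)"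
  by (simp add: lower_def coeff2_span_monom2)

text \<open>The family is unitriangular against the monomials, so each \<open>monom2 d\<close> is
  recovered by well-founded induction along \<open>prec\<close>.\<close>

lemma span_monic_family:
  assumes "\<And>d. q d - monom2 d \<in> lower d"
  shows "poly2.span (range q) = UNIV"
proof -
  have mem: "monom2 d \<in> poly2.span (range q)" for d
  proof (induction d rule: wf_induct_rule[OF wf_prec])
    case (1 d)
    then have "lower d \<subseteq> poly2.span (range q)"
      unfolding lower_def by (intro poly2.span_minimal) auto
    then have "q d - monom2 d \<in> poly2.span (range q)" using assms[of d] by blast
    moreover have "q d \<in> poly2.span (range q)" by (rule poly2.span_base) simp
    ultimately have "q d - (q d - monom2 d) \<in> poly2.span (range q)" by (rule poly2.span_diff[rotated])
    then show ?case by simp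
  qed
  then have "poly2.span (range monom2) \<subseteq> poly2.span (range q)"
    by (intro poly2.span_minimal) auto
  then show ?thesis by (simp add: span_range_monom2 top.extremum_unique)
qed

lemma linear_op_eqI:
  assumes "linear_op D" "linear_op E" "poly2.span (range q) = UNIV" "\<And>d. D (q d) = E (q d)"
  shows "D = E"
proof
  fix f
  interpret module_pair scale2 scale2 by unfold_locales
  show "D f = E f"
    by (rule module_hom_eq_on_span[OF assms(1,2), where B = "range q"]) (use assms(3,4) in auto)
qed

context koornwinder
begin

section \<open>Orthogonal projection and identification of \<open>q_poly\<close>\<close>

lemma L_simps:
  "L (f + g) = L f + L g" "L (f - g) = L f - L g" "L (scale2 r f) = r * L f" "L 0 = 0"
  using module_hom.add[OF linear_form_L] module_hom.diff[OF linear_form_L]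
    module_hom.scale[OF linear_form_L] module_hom.zero[OF linear_form_L] by auto

text \<open>Gram-Schmidt, one vector at a time: \<open>e\<close> is the part of \<open>b\<close>
  orthogonal to the old span, and only the projection onto \<open>e\<close> is added to
  \<open>y\<close>.\<close>

lemma orthogonal_projection:
  assumes "finite B"
  shows "\<exists>y\<in>poly2.span B. \<forall>z\<in>poly2.span B. L ((x - y) * z) = 0"
  using assms
proof (induction B arbitrary: x)
  case empty
  then show ?case by (auto simp: L_simps)
next
  case (insert b B)
  from insert.IH[of b] obtain b' where b': "b' \<in> poly2.span B" "\<And>z. z \<in> poly2.span B \<Longrightarrow> L ((b - b') * z) = 0"
    by blast
  from insert.IH[of x] obtain y where y: "y \<in> poly2.span B" "\<And>z. z \<in> poly2.span B \<Longrightarrow> L ((x - y) * z) = 0"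
    by blast
  define e where "e = b - b'"
  have span_mono: "poly2.span B \<subseteq> poly2.span (insert b B)" by (intro poly2.span_mono) auto
  have e_span: "e \<in> poly2.span (insert b B)"
    unfolding e_def using b'(1) span_mono by (intro poly2.span_diff[of b]) (auto intro: poly2.span_base)
  \<comment> \<open>If L (e * e) = 0 then e = 0 by positivity, so the division by zero is
    harmless.\<close>
  define y' where "y' = y + scale2 (L ((x - y) * e) / L (e * e)) e"
  show ?case
  proof
    show "y' \<in> poly2.span (insert b B)"
      unfolding y'_def using y(1) span_mono e_span by (intro poly2.span_add poly2.span_scale) auto
    show "\<forall>z\<in>poly2.span (insert b B). L ((x - y') * z) = 0"
    proof
      fix z assume "z \<in> poly2.span (insert b B)"
      then obtain k where "z - scale2 k b \<in> poly2.span B" by (auto simp: poly2.span_breakdown_eq)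
      moreover define z' where "z' = z - scale2 k e"
      moreover have "z' = (z - scale2 k b) + scale2 k b'" by (simp add: z'_def e_def poly2.scale_right_diff_distrib)
      ultimately have z': "z' \<in> poly2.span B" using b'(1) by (simp add: poly2.span_add poly2.span_scale)
      have z: "z = z' + scale2 k e" by (simp add: z'_def)
      have "L ((x - y') * e) = 0"
        using L_square_eq_0[of e]
        by (cases "L (e * e) = 0") (auto simp: y'_def algebra_simps scale2_mult L_simps diff_divide_distrib)
      moreover have "L ((x - y') * z') = 0"
        using y(2)[OF z'] b'(2)[OF z', folded e_def]
        by (simp add: y'_def algebra_simps scale2_mult L_simps)
      ultimately show "L ((x - y') * z) = 0"
        by (simp add: z distrib_left scale2_mult L_simps)
    qed
  qed
qed

definition monic_orthogonal :: "nat \<times> nat \<Rightarrow> poly2 \<Rightarrow> bool" where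
  "monic_orthogonal d f \<longleftrightarrow> f - monom2 d \<in> lower d \<and> (\<forall>g\<in>lower d. L (f * g) = 0)"

lemma monic_orthogonal_exists: "\<exists>f. monic_orthogonal d f"
proof -
  obtain y where "y \<in> lower d" "\<forall>z\<in>lower d. L ((monom2 d - y) * z) = 0"
    using orthogonal_projection[of "monom2 ` {s. prec s d}" "monom2 d"] finite_prec[of d]
    unfolding lower_def by auto
  then have "monic_orthogonal d (monom2 d - y)"
    using poly2.subspace_neg[OF subspace_lower] by (simp add: monic_orthogonal_def)
  then show ?thesis ..
qed

text \<open>The leading terms cancel, so f - g lies in \<open>lower d\<close> and is orthogonal to
  itself.\<close>

lemma monic_orthogonal_unique:
  assumes "monic_orthogonal d f" "monic_orthogonal d g"
  shows "f = g"
proof -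
  have "(f - monom2 d) - (g - monom2 d) \<in> lower d"
    using assms by (intro poly2.subspace_diff[OF subspace_lower, of "f - monom2 d"]) (auto simp: monic_orthogonal_def)
  then have "f - g \<in> lower d" by simp
  then have "L (f * (f - g)) - L (g * (f - g)) = 0" using assms by (simp add: monic_orthogonal_def)
  then have "L ((f - g) * (f - g)) = 0" by (simp add: left_diff_distrib L_simps)
  then show ?thesis using L_square_eq_0 by fastforce
qed

text \<open>Moves the defining condition of \<open>p_poly\<close> to the (u, v) side:
  \<open>sym_subst\<close> carries \<open>monom2\<close> to \<open>sym_monom\<close>, and
  orthogonality to all symmetric polynomials of smaller symmetric degree becomes orthogonality to
  \<open>lower d\<close>.\<close>

lemma p_poly_characterization:
  "symmetric2 P \<and>
     (\<exists>c. finite {s. c s \<noteq> 0} \<and> (\<forall>s. c s \<noteq> 0 \<longrightarrow> prec s d) \<and> P = sym_monom d + sym_comb c) \<and>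
     (\<forall>Q e. symmetric2 Q \<and> has_sym_degree Q e \<and> prec e d \<longrightarrow> inner_w \<alpha> \<gamma> \<kappa> P Q = 0)
   \<longleftrightarrow> (\<exists>f. P = sym_subst f \<and> monic_orthogonal d f)" (is "?A P \<longleftrightarrow> ?B P")
proof
  assume A: "?A P"
  then obtain c where c: "finite {s. c s \<noteq> 0}" "\<forall>s. c s \<noteq> 0 \<longrightarrow> prec s d" "P = sym_monom d + sym_comb c"
    by blast
  obtain r where r: "sym_comb c = sym_subst r" "coeff2 r = c" using sym_comb_eq_sym_subst[OF c(1)] .
  define f where "f = monom2 d + r"
  have P: "P = sym_subst f" by (simp add: f_def c(3) r(1) sym_subst_simps)
  have "r \<in> lower d" using c(2) by (simp add: lower_iff r(2))
  have orth: "L (f * monom2 e) = 0" if "prec e d" for e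
  proof -
    have "has_sym_degree (sym_subst (monom2 e)) e"
      unfolding has_sym_degree_def sym_subst_def
      by (rule exI[of _ "coeff2 (monom2 e)"]) (auto simp: coeff2_monom2 finite_coeff2)
    then show ?thesis using A that symmetric2_sym_subst inner_w_sym_subst P by metis
  qed
  have "L (f * g) = 0" if "g \<in> lower d" for g
    using that unfolding lower_def
    by (induction rule: poly2.span_induct_alt) (auto simp: L_simps distrib_left scale2_mult orth)
  then have "monic_orthogonal d f" using \<open>r \<in> lower d\<close> by (simp add: monic_orthogonal_def f_def)
  with P show "?B P" by blast
next
  assume "?B P"
  then obtain f where P: "P = sym_subst f" and f: "monic_orthogonal d f" by blast
  define r where "r = f - monom2 d"
  have "P = sym_monom d + sym_comb (coeff2 r)"
    unfolding P sym_subst_simps(3)[symmetric] sym_subst_def[symmetric]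
    by (simp add: r_def flip: sym_subst_simps(2))
  moreover have "\<forall>s. coeff2 r s \<noteq> 0 \<longrightarrow> prec s d"
    using f by (simp add: monic_orthogonal_def r_def lower_iff)
  moreover have "inner_w \<alpha> \<gamma> \<kappa> P Q = 0" if Q: "has_sym_degree Q e" "prec e d" for Q e
  proof -
    obtain c where c: "finite {s. c s \<noteq> 0}" "Q = sym_comb c" "\<forall>s. c s \<noteq> 0 \<longrightarrow> s = e \<or> prec s e"
      using Q(1) by (auto simp: has_sym_degree_def)
    obtain g where g: "sym_comb c = sym_subst g" "coeff2 g = c" using sym_comb_eq_sym_subst[OF c(1)] .
    have "g \<in> lower d" unfolding lower_iff g(2) using c(3) Q(2) prec_trans by blast
    with f show ?thesis by (simp add: P c(2) g(1) inner_w_sym_subst monic_orthogonal_def)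
  qed
  moreover have "symmetric2 P" by (simp add: P symmetric2_sym_subst)
  ultimately show "?A P" using finite_coeff2[of r] by (intro conjI exI[of _ "coeff2 r"]) auto
qed

lemma monic_orthogonal_q_poly: "monic_orthogonal (n, k) (q_poly \<alpha> \<gamma> \<kappa> n k)"
proof -
  obtain f where f: "monic_orthogonal (n, k) f" using monic_orthogonal_exists by blast
  have "p_poly \<alpha> \<gamma> \<kappa> n k = sym_subst f"
    unfolding p_poly_def p_poly_characterization
    by (rule the_equality) (use f monic_orthogonal_unique in blast)+
  then have "q_poly \<alpha> \<gamma> \<kappa> n k = f"
    unfolding q_poly_def
  proof (intro the_equality)
    fix Q assume "\<forall>x y. eval2 Q (x + y) (x * y) = eval2 (p_poly \<alpha> \<gamma> \<kappa> n k) x y"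
    then have "sym_subst Q = sym_subst f"
      using \<open>p_poly \<alpha> \<gamma> \<kappa> n k = sym_subst f\<close> by (intro eval2_eqI) simp
    then show "Q = f" by (rule sym_subst_inj)
  qed simp
  with f show ?thesis by simp
qed

text \<open>The leading term cancels in h = D f - \<mu> d f, so h and D h lie in
  \<open>lower d\<close>. Moving D across gives L (h * h) = L (f * D h) - \<mu> d L (f * h) =
  0.\<close>

lemma eigenfunction_of_selfadjoint:
  assumes lin: "linear_op D"
    and triangular: "\<And>s. D (monom2 s) - scale2 (\<mu> s) (monom2 s) \<in> lower s"
    and selfadjoint: "\<And>s t. L (D (monom2 s) * monom2 t) = L (monom2 s * D (monom2 t))"
    and f: "monic_orthogonal d f"
  shows "D f = scale2 (\<mu> d) f"
proof -
  note D = module_hom.add[OF lin] module_hom.diff[OF lin] module_hom.scale[OF lin] module_hom.zero[OF lin]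
  have D_lower: "D g \<in> lower d" if "g \<in> lower d" for g
    using that unfolding lower_def[of d]
  proof (induction rule: poly2.span_induct_alt)
    case base
    then show ?case by (simp add: D poly2.span_zero)
  next
    case (step r h g)
    then obtain s where s: "h = monom2 s" "prec s d" by auto
    have "(D h - scale2 (\<mu> s) h) + scale2 (\<mu> s) h \<in> lower d"
      using s triangular[of s] lower_mono[OF s(2)] monom2_in_lower[OF s(2)]
      by (intro poly2.subspace_add[OF subspace_lower] poly2.subspace_scale[OF subspace_lower]) auto
    with step show ?case
      by (simp add: D lower_def[symmetric] poly2.subspace_add[OF subspace_lower] poly2.subspace_scale[OF subspace_lower])
  qed
  have sa1: "L (D g * monom2 t) = L (g * D (monom2 t))" for g t
  proof -
    have "g \<in> poly2.span (range monom2)" by (simp add: span_range_monom2)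
    then show ?thesis
      by (induction rule: poly2.span_induct_alt)
        (auto simp: D L_simps distrib_right scale2_mult selfadjoint)
  qed
  have sa: "L (D g * h) = L (g * D h)" for g h
  proof -
    have "h \<in> poly2.span (range monom2)" by (simp add: span_range_monom2)
    then show ?thesis
      by (induction rule: poly2.span_induct_alt)
        (auto simp: D L_simps distrib_left scale2_mult sa1)
  qed
  define r where "r = f - monom2 d"
  have "r \<in> lower d" using f by (simp add: monic_orthogonal_def r_def)
  define h where "h = D f - scale2 (\<mu> d) f"
  have "f = monom2 d + r" by (simp add: r_def)
  then have "h = (D (monom2 d) - scale2 (\<mu> d) (monom2 d)) + (D r - scale2 (\<mu> d) r)"
    by (simp add: h_def D poly2.scale_right_distrib)
  then have "h \<in> lower d"
    using triangular \<open>r \<in> lower d\<close> D_lower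
    by (simp add: poly2.subspace_add[OF subspace_lower] poly2.subspace_diff[OF subspace_lower]
      poly2.subspace_scale[OF subspace_lower])
  then have "L (f * D h) = 0" "L (f * h) = 0"
    using f D_lower by (auto simp: monic_orthogonal_def)
  moreover have "L (h * h) = L (D f * h) - \<mu> d * L (f * h)"
    by (simp add: h_def[of] left_diff_distrib L_simps scale2_mult)
  ultimately have "L (h * h) = 0" by (simp add: sa)
  then show ?thesis using L_square_eq_0[of h] by (simp add: h_def)
qed

end

subsection \<open>Differential operators\<close>

declare mult_pCons_left [simp del]

lemma is_diff_op_zero: "is_diff_op (\<lambda>f. 0)"
  unfolding is_diff_op_def by (rule exI[of _ "{}"]) simp

lemma is_diff_op_monomial: "is_diff_op (\<lambda>f. p * (deriv_u ^^ r) ((deriv_v ^^ s) f))"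
  unfolding is_diff_op_def by (rule exI[of _ "{(r, s)}"], rule exI[of _ "\<lambda>_ _. p"]) simp

lemma is_diff_op_add:
  assumes "is_diff_op D" "is_diff_op E"
  shows "is_diff_op (\<lambda>f. D f + E f)"
proof -
  obtain S p where S: "finite S" "D = (\<lambda>f. \<Sum>(r, s)\<in>S. p r s * (deriv_u ^^ r) ((deriv_v ^^ s) f))"
    using assms(1) by (auto simp: is_diff_op_def)
  obtain T q where T: "finite T" "E = (\<lambda>f. \<Sum>(r, s)\<in>T. q r s * (deriv_u ^^ r) ((deriv_v ^^ s) f))"
    using assms(2) by (auto simp: is_diff_op_def)
  define p' where "p' r s = (if (r, s) \<in> S then p r s else 0)" for r s
  define q' where "q' r s = (if (r, s) \<in> T then q r s else 0)" for r s
  have "D f = (\<Sum>(r, s)\<in>S \<union> T. p' r s * (deriv_u ^^ r) ((deriv_v ^^ s) f))" for f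
    unfolding S(2) using S(1) T(1) by (intro sum.mono_neutral_cong_left) (auto simp: p'_def)
  moreover have "E f = (\<Sum>(r, s)\<in>S \<union> T. q' r s * (deriv_u ^^ r) ((deriv_v ^^ s) f))" for f
    unfolding T(2) using S(1) T(1) by (intro sum.mono_neutral_cong_left) (auto simp: q'_def)
  ultimately have "(\<lambda>f. D f + E f) =
      (\<lambda>f. \<Sum>(r, s)\<in>S \<union> T. (p' r s + q' r s) * (deriv_u ^^ r) ((deriv_v ^^ s) f))"
    by (simp add: fun_eq_iff distrib_right sum.distrib case_prod_unfold)
  then show ?thesis
    unfolding is_diff_op_def using S(1) T(1)
    by (intro exI[of _ "S \<union> T"] exI[of _ "\<lambda>r s. p' r s + q' r s"]) simp
qed

lemma is_diff_op_sum:
  "finite A \<Longrightarrow> (\<And>x. x \<in> A \<Longrightarrow> is_diff_op (D x)) \<Longrightarrow> is_diff_op (\<lambda>f. \<Sum>x\<in>A. D x f)"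
  by (induction A rule: finite_induct) (auto intro: is_diff_op_zero is_diff_op_add)

lemma is_diff_op_induct [consumes 1, case_names zero add monomial]:
  assumes "is_diff_op D"
    and "P (\<lambda>f. 0)"
    and "\<And>D E. is_diff_op D \<Longrightarrow> is_diff_op E \<Longrightarrow> P D \<Longrightarrow> P E \<Longrightarrow> P (\<lambda>f. D f + E f)"
    and "\<And>p r s. P (\<lambda>f. p * (deriv_u ^^ r) ((deriv_v ^^ s) f))"
  shows "P D"
proof -
  obtain S p where S: "finite S" "D = (\<lambda>f. \<Sum>(r, s)\<in>S. p r s * (deriv_u ^^ r) ((deriv_v ^^ s) f))"
    using assms(1) by (auto simp: is_diff_op_def)
  have "P (\<lambda>f. \<Sum>(r, s)\<in>S. p r s * (deriv_u ^^ r) ((deriv_v ^^ s) f))"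
    using S(1)
  proof (induction S rule: finite_induct)
    case (insert x S)
    obtain r s where x: "x = (r, s)" by fastforce
    have "P (\<lambda>f. p r s * (deriv_u ^^ r) ((deriv_v ^^ s) f) +
        (\<Sum>(r, s)\<in>S. p r s * (deriv_u ^^ r) ((deriv_v ^^ s) f)))"
      by (rule assms(3)[OF is_diff_op_monomial _ assms(4) insert.IH])
        (use insert.hyps(1) in \<open>auto simp: is_diff_op_def\<close>)
    then show ?case using insert.hyps by (simp add: x)
  qed (simp add: assms(2))
  then show ?thesis by (simp add: S(2))
qed

lemma linear_op_diff_op: "is_diff_op D \<Longrightarrow> linear_op D"
proof (induction rule: is_diff_op_induct)
  case zero
  then show ?case by (rule linear_opI) simp_all
next
  case (add D E)
  then show ?case by (simp add: module_hom_iff poly2.scale_right_distrib)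
next
  case (monomial p r s)
  show ?case
    by (intro linear_op_compose[OF linear_op_mult_left] linear_op_compose[OF linear_op_funpow[OF linear_op_deriv_u]]
      linear_op_funpow linear_op_deriv_v)
qed

lemma is_diff_op_mult_left: "is_diff_op D \<Longrightarrow> is_diff_op (\<lambda>f. p * D f)"
proof (induction rule: is_diff_op_induct)
  case (monomial q r s)
  show ?case using is_diff_op_monomial[of "p * q" r s] by (simp add: mult.assoc)
qed (simp_all add: is_diff_op_zero is_diff_op_add distrib_left)

lemma is_diff_op_scale2: "is_diff_op D \<Longrightarrow> is_diff_op (\<lambda>f. scale2 r (D f))"
  using is_diff_op_mult_left[of D "[:[:r:]:]"] by (simp add: scale2_def mult_pCons_left)

lemma is_diff_op_diff: "is_diff_op D \<Longrightarrow> is_diff_op E \<Longrightarrow> is_diff_op (\<lambda>f. D f - E f)"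
  using is_diff_op_add[of D "\<lambda>f. scale2 (-1) (E f)"] is_diff_op_scale2[of E "-1"] by simp

lemma deriv_u_mult: "deriv_u (p * q) = deriv_u p * q + p * deriv_u q"
proof (rule poly_eqI)
  fix n
  show "coeff (deriv_u (p * q)) n = coeff (deriv_u p * q + p * deriv_u q) n"
    unfolding coeff_deriv_u coeff_add coeff_mult higher_pderiv_sum[where n = 1, simplified] pderiv_mult sum.distrib
    by (simp add: mult.commute add.commute)
qed

lemma deriv_v_mult: "deriv_v (p * q) = deriv_v p * q + p * deriv_v q"
  by (simp add: deriv_v_def pderiv_mult algebra_simps)

lemma deriv_u_v_commute: "deriv_u (deriv_v f) = deriv_v (deriv_u f)"
proof -
  have "coeff (deriv_u (deriv_v f)) j = coeff (deriv_v (deriv_u f)) j" for j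
    by (simp add: coeff_deriv_u deriv_v_def coeff_pderiv pderiv_mult of_nat_poly pderiv_pCons del: of_nat_Suc)
  then show ?thesis by (rule poly_eqI)
qed

lemma deriv_v_deriv_u_funpow: "deriv_v ((deriv_u ^^ r) f) = (deriv_u ^^ r) (deriv_v f)"
  by (induction r) (simp_all flip: deriv_u_v_commute)

text \<open>By the Leibniz rule the new derivative either falls on the coefficient \<open>p\<close>
  or raises the order of the term.\<close>

lemma is_diff_op_deriv_u: "is_diff_op D \<Longrightarrow> is_diff_op (\<lambda>f. deriv_u (D f))"
proof (induction rule: is_diff_op_induct)
  case zero
  then show ?case by (simp add: is_diff_op_zero module_hom.zero[OF linear_op_deriv_u])
next
  case (add D E)
  then show ?case by (simp add: is_diff_op_add module_hom.add[OF linear_op_deriv_u])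
next
  case (monomial p r s)
  show ?case
    using is_diff_op_add[OF is_diff_op_monomial[of "deriv_u p" r s] is_diff_op_monomial[of p "Suc r" s]]
    by (simp add: deriv_u_mult)
qed

lemma is_diff_op_deriv_v: "is_diff_op D \<Longrightarrow> is_diff_op (\<lambda>f. deriv_v (D f))"
proof (induction rule: is_diff_op_induct)
  case zero
  then show ?case by (simp add: is_diff_op_zero module_hom.zero[OF linear_op_deriv_v])
next
  case (add D E)
  then show ?case by (simp add: is_diff_op_add module_hom.add[OF linear_op_deriv_v])
next
  case (monomial p r s)
  show ?case
    using is_diff_op_add[OF is_diff_op_monomial[of "deriv_v p" r s] is_diff_op_monomial[of p r "Suc s"]]
    by (simp add: deriv_v_mult deriv_v_deriv_u_funpow)
qed

lemma is_diff_op_ident: "is_diff_op (\<lambda>f. f)"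
  using is_diff_op_monomial[of 1 0 0] by simp

lemmas is_diff_op_intros = is_diff_op_add is_diff_op_diff is_diff_op_scale2 is_diff_op_mult_left
  is_diff_op_deriv_u is_diff_op_deriv_v

section \<open>Variables and derivatives acting on monomials\<close>

lemma fst_var_monom2: "fst_var * monom2 (i, j) = monom2 (Suc i, j)"
  by (simp add: monom2_def monom_Suc smult_monom mult_pCons_left)

lemma snd_var_monom2: "snd_var * monom2 (i, j) = monom2 (i, Suc j)"
  by (simp add: monom2_def monom_Suc mult_pCons_left)

lemma deriv_u_monom2: "deriv_u (monom2 (i, j)) = scale2 (real i) (monom2 (i - 1, j))"
  by (simp add: monom2_def deriv_u_def map_poly_monom pderiv_monom scale2_def smult_monom mult_pCons_left)

lemma deriv_v_monom2: "deriv_v (monom2 (i, j)) = scale2 (real j) (monom2 (i, j - 1))"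
  by (simp add: monom2_def deriv_v_def pderiv_monom scale2_def smult_monom of_nat_poly mult.commute mult_pCons_left)

lemma fst_var_deriv_u_monom2: "fst_var * deriv_u (monom2 (i, j)) = scale2 (real i) (monom2 (i, j))"
  by (cases i) (simp_all add: deriv_u_monom2 scale2_mult fst_var_monom2 del: of_nat_Suc)

lemma snd_var_deriv_v_monom2: "snd_var * deriv_v (monom2 (i, j)) = scale2 (real j) (monom2 (i, j))"
  by (cases j) (simp_all add: deriv_v_monom2 scale2_mult snd_var_monom2 del: of_nat_Suc)

lemma of_nat_mult_pred: "real i * real (i - 1) = real i * (real i - 1)"
  by (cases i) auto

lemma deriv_scale2: "deriv_u (scale2 r f) = scale2 r (deriv_u f)" "deriv_v (scale2 r f) = scale2 r (deriv_v f)"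
  using module_hom.scale[OF linear_op_deriv_u] module_hom.scale[OF linear_op_deriv_v] by auto

text \<open>The weighted Euler operator, with u of degree 1 and v of degree 2; it is u d/du at fixed
  z = 4 v / u^2.\<close>

definition euler_op :: "poly2 \<Rightarrow> poly2" where
  "euler_op f = fst_var * deriv_u f + scale2 2 (snd_var * deriv_v f)"

lemma euler_op_scale2: "euler_op (scale2 r f) = scale2 r (euler_op f)"
  by (simp only: euler_op_def deriv_scale2 scale2_mult scale2_simps mult.commute[of _ "r"])

context koornwinder
begin

text \<open>In z = 4 v / u^2 at fixed u this is z (1 - z) d_z^2 + (\<alpha> + 1 - (a + 1) z) d_z,
  the Jacobi operator of the weight z^\<alpha> (1 - z)^\<kappa>.\<close>

definition angular_op :: "poly2 \<Rightarrow> poly2" where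
  "angular_op f = scale2 (1/4) (fst_var * (fst_var * (snd_var * deriv_v (deriv_v f))))
     - snd_var * (snd_var * deriv_v (deriv_v f))
     + scale2 ((\<alpha> + 1) / 4) (fst_var * (fst_var * deriv_v f)) - scale2 (a + 1) (snd_var * deriv_v f)"

text \<open>With E = \<open>euler_op\<close> and A = \<open>angular_op\<close> this equals u^(-1)
  (E^2 + 2 a E + 4 A) - E (E + c); the division by u is exact, so the coefficients are
  polynomials.\<close>

definition radial_op :: "poly2 \<Rightarrow> poly2" where
  "radial_op f = fst_var * deriv_u (deriv_u f) + scale2 4 (snd_var * deriv_v (deriv_u f))
     + fst_var * (snd_var * deriv_v (deriv_v f)) + scale2 (2 * a + 1) (deriv_u f)
     + scale2 (\<alpha> + 1) (fst_var * deriv_v f) - (euler_op (euler_op f) + scale2 c (euler_op f))"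

definition angular_eigenvalue :: "nat \<times> nat \<Rightarrow> real" where
  "angular_eigenvalue s = - (real (snd s) * (real (snd s) + a))"

definition radial_eigenvalue :: "nat \<times> nat \<Rightarrow> real" where
  "radial_eigenvalue s = (let N = real (fst s + 2 * snd s) in - (N * (N + c)))"

lemma is_diff_op_angular: "is_diff_op D \<Longrightarrow> is_diff_op (\<lambda>f. angular_op (D f))"
  unfolding angular_op_def by (intro is_diff_op_intros)

lemma is_diff_op_radial: "is_diff_op D \<Longrightarrow> is_diff_op (\<lambda>f. radial_op (D f))"
  unfolding radial_op_def euler_op_def by (intro is_diff_op_intros)

lemma linear_op_angular: "linear_op angular_op" and linear_op_radial: "linear_op radial_op"
  using linear_op_diff_op[OF is_diff_op_angular[OF is_diff_op_ident]]
    linear_op_diff_op[OF is_diff_op_radial[OF is_diff_op_ident]] by simp_all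

text \<open>The exponent j - 1 truncates only at j = 0, where its coefficient vanishes.\<close>

lemma angular_op_monom2:
  "angular_op (monom2 (i, j)) = scale2 (real j * (real j + \<alpha>) / 4) (monom2 (i + 2, j - 1))
     + scale2 (angular_eigenvalue (i, j)) (monom2 (i, j))"
proof -
  let ?m = "monom2 (i, j)"
  have vv: "snd_var * deriv_v (deriv_v ?m) = scale2 (real j * (real j - 1)) (monom2 (i, j - 1))"
    by (simp only: deriv_v_monom2[of i j] deriv_scale2 scale2_mult snd_var_deriv_v_monom2 scale2_simps of_nat_mult_pred)
  have v: "fst_var * (fst_var * deriv_v ?m) = scale2 (real j) (monom2 (i + 2, j - 1))"
    by (simp add: deriv_v_monom2 scale2_mult fst_var_monom2)
  have uvv: "fst_var * (fst_var * (snd_var * deriv_v (deriv_v ?m))) =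
      scale2 (real j * (real j - 1)) (monom2 (i + 2, j - 1))"
    unfolding vv by (simp add: scale2_mult fst_var_monom2)
  have vvv: "snd_var * (snd_var * deriv_v (deriv_v ?m)) = scale2 (real j * (real j - 1)) ?m"
    unfolding vv by (cases j) (simp_all add: scale2_mult snd_var_monom2)
  show ?thesis
    unfolding angular_op_def uvv vvv v snd_var_deriv_v_monom2
    by (rule coeff2_eqI) (simp add: angular_eigenvalue_def field_simps)
qed

lemma euler_op_monom2: "euler_op (monom2 (i, j)) = scale2 (real (i + 2 * j)) (monom2 (i, j))"
  unfolding euler_op_def fst_var_deriv_u_monom2 snd_var_deriv_v_monom2 by (simp add: scale2_simps)

lemma radial_op_monom2:
  "radial_op (monom2 (i, j)) = scale2 (real i * (real i + 4 * real j + 2 * a)) (monom2 (i - 1, j))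
     + scale2 (real j * (real j + \<alpha>)) (monom2 (i + 1, j - 1))
     + scale2 (radial_eigenvalue (i, j)) (monom2 (i, j))"
proof -
  let ?m = "monom2 (i, j)"
  have uu: "fst_var * deriv_u (deriv_u ?m) = scale2 (real i * (real i - 1)) (monom2 (i - 1, j))"
    by (simp only: deriv_u_monom2[of i j] deriv_scale2 scale2_mult fst_var_deriv_u_monom2 scale2_simps of_nat_mult_pred)
  have vu: "snd_var * deriv_v (deriv_u ?m) = scale2 (real i * real j) (monom2 (i - 1, j))"
    by (simp add: deriv_u_monom2 deriv_scale2 scale2_mult snd_var_deriv_v_monom2)
  have vv: "fst_var * (snd_var * deriv_v (deriv_v ?m)) = scale2 (real j * (real j - 1)) (monom2 (i + 1, j - 1))"
    by (simp only: deriv_v_monom2[of i j] deriv_scale2 scale2_mult snd_var_deriv_v_monom2 scale2_simps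
      of_nat_mult_pred fst_var_monom2) simp
  have v: "fst_var * deriv_v ?m = scale2 (real j) (monom2 (i + 1, j - 1))"
    by (simp add: deriv_v_monom2 scale2_mult fst_var_monom2)
  have ee: "euler_op (euler_op ?m) = scale2 (real (i + 2 * j) * real (i + 2 * j)) ?m"
    by (simp only: euler_op_monom2 euler_op_scale2 scale2_simps)
  show ?thesis
    unfolding radial_op_def uu vu vv v ee unfolding euler_op_monom2 deriv_u_monom2
    by (rule coeff2_eqI) (simp add: radial_eigenvalue_def Let_def algebra_simps)
qed

text \<open>The other monomial has the same weighted degree i + 2 j but a smaller power of
  v.\<close>

lemma angular_op_triangular: "angular_op (monom2 s) - scale2 (angular_eigenvalue s) (monom2 s) \<in> lower s"
proof (cases s)
  case (Pair i j)
  have "scale2 (real j * (real j + \<alpha>) / 4) (monom2 (i + 2, j - 1)) \<in> lower (i, j)"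
    by (cases "j = 0")
      (auto simp: prec_def poly2.subspace_0[OF subspace_lower]
        intro!: poly2.subspace_scale[OF subspace_lower] monom2_in_lower)
  then show ?thesis by (simp add: Pair angular_op_monom2)
qed

text \<open>Both other monomials have weighted degree i + 2 j - 1.\<close>

lemma radial_op_triangular: "radial_op (monom2 s) - scale2 (radial_eigenvalue s) (monom2 s) \<in> lower s"
proof (cases s)
  case (Pair i j)
  have "scale2 (real i * (real i + 4 * real j + 2 * a)) (monom2 (i - 1, j)) \<in> lower (i, j)"
    by (cases "i = 0")
      (auto simp: prec_def poly2.subspace_0[OF subspace_lower]
        intro!: poly2.subspace_scale[OF subspace_lower] monom2_in_lower)
  moreover have "scale2 (real j * (real j + \<alpha>)) (monom2 (i + 1, j - 1)) \<in> lower (i, j)"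
    by (cases "j = 0")
      (auto simp: prec_def poly2.subspace_0[OF subspace_lower]
        intro!: poly2.subspace_scale[OF subspace_lower] monom2_in_lower)
  ultimately show ?thesis by (simp add: Pair radial_op_monom2 poly2.subspace_add[OF subspace_lower])
qed

section \<open>Self-adjointness from the moment recurrences\<close>

lemma angular_moment_pred:
  assumes "j > 0"
  shows "angular_moment (j - 1) = 4 * (real j + a) * angular_moment j / (real j + \<alpha>)"
proof -
  obtain n where "j = Suc n" using assms by (cases j) auto
  then show ?thesis using angular_moment_Suc[of n] \<alpha> by (simp add: field_simps)
qed

lemma radial_moment_pred:
  assumes "t > 0"
  shows "radial_moment t = (real t + 2 * a) * radial_moment (t - 1) / (real t + c)"
proof -
  obtain n where "t = Suc n" using assms by (cases t) auto
  then show ?thesis using radial_moment_Suc[of n] c_gt by (simp add: field_simps)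
qed

text \<open>The right-hand side is symmetric under exchange of (i, j) and (k, l), which is
  self-adjointness on monomials. As a - \<alpha> = \<kappa> + 1, it is the Dirichlet form: minus the
  integral of z (1 - z) f_z g_z against the weight.\<close>

lemma L_angular_op:
  "L (angular_op (monom2 (i, j)) * monom2 (k, l)) =
    - (radial_moment (i + k + 2 * (j + l)) * angular_moment (j + l) *
      (real j * real l * (a - \<alpha>) / (real j + real l + \<alpha>)))"
proof (cases "j = 0")
  case True
  then show ?thesis
    by (simp add: angular_op_monom2 distrib_right scale2_mult L_simps angular_eigenvalue_def)
next
  case False
  define J where "J = real j + real l"
  have J: "J + \<alpha> \<noteq> 0" "real (j + l) = J" using False \<alpha> by (auto simp: J_def)
  have idx: "i + 2 + k + 2 * (j + l - 1) = i + k + 2 * (j + l)" "i + 2 + k + 2 * (j - 1 + l) = i + k + 2 * (j + l)" "j - 1 + l = j + l - 1"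
    using False by auto
  have "L (angular_op (monom2 (i, j)) * monom2 (k, l)) =
      radial_moment (i + k + 2 * (j + l)) * (real j * (real j + \<alpha>) / 4 * angular_moment (j + l - 1)
        + angular_eigenvalue (i, j) * angular_moment (j + l))"
    unfolding angular_op_monom2 distrib_right scale2_mult L_simps monom2_mult L_monom2 idx
    by (simp add: algebra_simps)
  also have "angular_moment (j + l - 1) = 4 * (J + a) * angular_moment (j + l) / (J + \<alpha>)"
    using angular_moment_pred[of "j + l"] False unfolding J by simp
  also have "real j * (real j + \<alpha>) / 4 * (4 * (J + a) * angular_moment (j + l) / (J + \<alpha>))
        + angular_eigenvalue (i, j) * angular_moment (j + l) =
      real j * angular_moment (j + l) * ((real j + \<alpha>) * (J + a) / (J + \<alpha>) - (real j + a))"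
    using J(1) by (simp add: angular_eigenvalue_def field_simps)
  also have "(real j + \<alpha>) * (J + a) / (J + \<alpha>) - (real j + a) = - (real l * (a - \<alpha>) / (J + \<alpha>))"
    using J(1) by (simp add: J_def field_simps)
  finally show ?thesis by (simp add: J_def)
qed

text \<open>Again symmetric in the two monomials: four times the angular form plus a radial form
  with factor c - 2 a = \<gamma> + 1. Where the index of \<open>radial_moment\<close> truncates,
  both sides are 0.\<close>

lemma L_radial_op:
  "L (radial_op (monom2 (i, j)) * monom2 (k, l)) =
    - (radial_moment (i + k + 2 * (j + l) - 1) * angular_moment (j + l) *
      (4 * (real j * real l * (a - \<alpha>) / (real j + real l + \<alpha>)) +
       real (i + 2 * j) * real (k + 2 * l) * (c - 2 * a) / (real (i + 2 * j) + real (k + 2 * l) + c)))"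
proof (cases "i + 2 * j = 0")
  case True
  then show ?thesis
    by (simp add: radial_op_monom2 distrib_right scale2_mult L_simps radial_eigenvalue_def)
next
  case False
  define N where "N = real (i + 2 * j)"
  define T where "T = N + real (k + 2 * l)"
  define J where "J = real j + real l"
  define t where "t = i + k + 2 * (j + l)"
  have T: "T + c \<noteq> 0" "real t = T" "t > 0" using False c_gt by (auto simp: T_def N_def t_def)
  \<comment> \<open>The prefactors \<open>real i\<close> and \<open>real j\<close> cover the cases i
    = 0 and j = 0, where the subtraction truncates.\<close>
  have idx1: "real i * radial_moment (i - 1 + k + 2 * (j + l)) = real i * radial_moment (t - 1)"
    by (cases i) (auto simp: t_def)
  have idx2: "real j * (radial_moment (i + 1 + k + 2 * (j - 1 + l)) * angular_moment (j - 1 + l)) =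
      real j * (radial_moment (t - 1) * angular_moment (j + l - 1))"
    by (cases j) (auto simp: t_def)
  have "L (radial_op (monom2 (i, j)) * monom2 (k, l)) =
      (real i + 4 * real j + 2 * a) * (real i * radial_moment (i - 1 + k + 2 * (j + l))) * angular_moment (j + l)
      + (real j + \<alpha>) * (real j * (radial_moment (i + 1 + k + 2 * (j - 1 + l)) * angular_moment (j - 1 + l)))
      + radial_eigenvalue (i, j) * (radial_moment t * angular_moment (j + l))"
    unfolding radial_op_monom2 distrib_right scale2_mult L_simps monom2_mult L_monom2
    by (simp add: t_def algebra_simps)
  also have "\<dots> =
      (real i + 4 * real j + 2 * a) * (real i * radial_moment (t - 1)) * angular_moment (j + l)
      + (real j + \<alpha>) * (real j * (radial_moment (t - 1) * angular_moment (j + l - 1)))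
      + radial_eigenvalue (i, j) * (radial_moment t * angular_moment (j + l))"
    unfolding idx1 idx2 ..
  also have "(real j + \<alpha>) * (real j * (radial_moment (t - 1) * angular_moment (j + l - 1))) =
      radial_moment (t - 1) * angular_moment (j + l) *
      (4 * (real j * (real j + a)) - 4 * (real j * real l * (a - \<alpha>) / (J + \<alpha>)))"
  proof (cases "j = 0")
    case j: False
    then have J: "J + \<alpha> \<noteq> 0" "real (j + l) = J" using \<alpha> by (auto simp: J_def)
    have "angular_moment (j + l - 1) = 4 * (J + a) * angular_moment (j + l) / (J + \<alpha>)"
      using angular_moment_pred[of "j + l"] j unfolding J by simp
    then have "(real j + \<alpha>) * (real j * (radial_moment (t - 1) * angular_moment (j + l - 1))) =
        radial_moment (t - 1) * angular_moment (j + l) * (4 * real j * ((real j + \<alpha>) * (J + a) / (J + \<alpha>)))"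
      by simp
    also have "(real j + \<alpha>) * (J + a) / (J + \<alpha>) = (real j + a) - real l * (a - \<alpha>) / (J + \<alpha>)"
      using J(1) by (simp add: J_def field_simps)
    finally show ?thesis by (simp add: algebra_simps)
  qed simp
  also have "radial_moment t = (T + 2 * a) * radial_moment (t - 1) / (T + c)"
    using radial_moment_pred[OF T(3)] by (simp add: T(2))
  also have "radial_eigenvalue (i, j) * ((T + 2 * a) * radial_moment (t - 1) / (T + c) * angular_moment (j + l)) =
      - (radial_moment (t - 1) * angular_moment (j + l) * (N * (N + c) * (T + 2 * a) / (T + c)))"
    by (simp add: radial_eigenvalue_def N_def Let_def)
  \<comment> \<open>Separates the symmetric term from N (N + 2 a), which depends on (i, j) alone and
    cancels below because N = i + 2 j.\<close>
  also have "N * (N + c) * (T + 2 * a) / (T + c) =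
      N * (N + 2 * a) + N * real (k + 2 * l) * (c - 2 * a) / (T + c)"
    using T(1) by (simp add: T_def field_simps)
  finally have "L (radial_op (monom2 (i, j)) * monom2 (k, l)) =
      radial_moment (t - 1) * angular_moment (j + l) *
      (real i * (real i + 4 * real j + 2 * a) + 4 * (real j * (real j + a)) - N * (N + 2 * a)
       - 4 * (real j * real l * (a - \<alpha>) / (J + \<alpha>)) - N * real (k + 2 * l) * (c - 2 * a) / (T + c))"
    by (simp add: algebra_simps)
  also have "real i * (real i + 4 * real j + 2 * a) + 4 * (real j * (real j + a)) - N * (N + 2 * a) = 0"
    by (simp add: N_def algebra_simps)
  finally show ?thesis by (simp add: t_def J_def T_def N_def algebra_simps)
qed

lemma angular_op_selfadjoint: "L (angular_op (monom2 s) * monom2 t) = L (monom2 s * angular_op (monom2 t))"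
proof -
  obtain i j k l where st: "s = (i, j)" "t = (k, l)" by fastforce
  show ?thesis
    using L_angular_op[of i j k l] L_angular_op[of k l i j] by (simp add: st ac_simps)
qed

lemma radial_op_selfadjoint: "L (radial_op (monom2 s) * monom2 t) = L (monom2 s * radial_op (monom2 t))"
proof -
  obtain i j k l where st: "s = (i, j)" "t = (k, l)" by fastforce
  show ?thesis
    using L_radial_op[of i j k l] L_radial_op[of k l i j] by (simp add: st ac_simps)
qed

section \<open>The \<open>q_poly\<close> as common eigenfunctions\<close>

abbreviation q :: "nat \<times> nat \<Rightarrow> poly2" where
  "q d \<equiv> q_poly \<alpha> \<gamma> \<kappa> (fst d) (snd d)"

lemma monic_orthogonal_q: "monic_orthogonal d (q d)"
  using monic_orthogonal_q_poly[of "fst d" "snd d"] by simp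

lemma angular_op_q: "angular_op (q d) = scale2 (angular_eigenvalue d) (q d)"
  by (rule eigenfunction_of_selfadjoint[OF linear_op_angular angular_op_triangular
    angular_op_selfadjoint monic_orthogonal_q])

lemma radial_op_q: "radial_op (q d) = scale2 (radial_eigenvalue d) (q d)"
  by (rule eigenfunction_of_selfadjoint[OF linear_op_radial radial_op_triangular
    radial_op_selfadjoint monic_orthogonal_q])

lemma span_q: "poly2.span (range q) = UNIV"
  by (rule span_monic_family) (use monic_orthogonal_q in \<open>auto simp: monic_orthogonal_def\<close>)

lemma q_nonzero: "q d \<noteq> 0"
proof
  assume "q d = 0"
  then have "coeff2 (q d - monom2 d) d \<noteq> 0" by (simp only: coeff2_simps coeff2_monom2) simp
  moreover have "q d - monom2 d \<in> lower d" using monic_orthogonal_q by (simp add: monic_orthogonal_def)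
  ultimately have "prec d d" unfolding lower_iff by blast
  then show False by (simp add: prec_def)
qed

end

subsection \<open>Evaluation at the corner\<close>

text \<open>Applied to the coefficient of v^j, this gives the partial derivatives at the corner up
  to a factor j!.\<close>

definition deriv_at_1 :: "nat \<Rightarrow> real poly \<Rightarrow> real" where
  "deriv_at_1 i h = poly ((pderiv ^^ i) h) 1"

lemma deriv_at_1_simps [simp]:
  "deriv_at_1 i (g + h) = deriv_at_1 i g + deriv_at_1 i h"
  "deriv_at_1 i (g - h) = deriv_at_1 i g - deriv_at_1 i h"
  "deriv_at_1 i (smult r h) = r * deriv_at_1 i h"
  "deriv_at_1 i 0 = 0"
  "deriv_at_1 i (pderiv h) = deriv_at_1 (Suc i) h"
proof -
  show "deriv_at_1 i (g - h) = deriv_at_1 i g - deriv_at_1 i h"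
    using higher_pderiv_add[of i g "smult (-1) h"] higher_pderiv_smult[of i "-1" h]
    by (simp add: deriv_at_1_def)
qed (simp_all add: deriv_at_1_def higher_pderiv_add higher_pderiv_smult funpow_Suc_right del: funpow.simps)

lemma deriv_at_1_x_mult:
  "deriv_at_1 i ([:0, 1:] * h) = deriv_at_1 i h + real i * deriv_at_1 (i - 1) h"
proof (induction i arbitrary: h)
  case 0
  then show ?case by (simp add: deriv_at_1_def)
next
  case (Suc i)
  have "deriv_at_1 (Suc i) ([:0, 1:] * h) = deriv_at_1 i (pderiv ([:0, 1:] * h))" by simp
  also have "pderiv ([:0, 1:] * h) = h + [:0, 1:] * pderiv h"
    by (simp add: pderiv_mult pderiv_pCons)
  also have "deriv_at_1 i (h + [:0, 1:] * pderiv h) =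
      deriv_at_1 i h + deriv_at_1 (Suc i) h + real i * deriv_at_1 (Suc (i - 1)) h"
    by (simp only: deriv_at_1_simps Suc.IH)
  finally show ?case by (cases i) (simp_all add: algebra_simps)
qed

lemma deriv_at_1_x2_mult:
  "deriv_at_1 i ([:0, 1:] * ([:0, 1:] * h)) = deriv_at_1 i h + 2 * real i * deriv_at_1 (i - 1) h
    + real i * (real i - 1) * deriv_at_1 (i - 2) h"
  unfolding deriv_at_1_x_mult by (cases i) (simp_all add: algebra_simps numeral_2_eq_2)

text \<open>The derivative of order \<open>degree h\<close> is the constant (degree h)! times the
  leading coefficient.\<close>

lemma deriv_at_1_all_0_imp_eq_0:
  assumes "\<And>i. deriv_at_1 i h = 0"
  shows "h = 0"
proof (rule ccontr)
  assume "h \<noteq> 0"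
  let ?g = "(pderiv ^^ degree h) h"
  have "degree ?g = 0" by (simp add: degree_higher_pderiv)
  then have "poly ?g 1 = coeff ?g 0" by (auto elim: degree_eq_zeroE)
  also have "\<dots> = pochhammer 1 (degree h) * lead_coeff h" by (simp add: coeff_higher_pderiv)
  also have "\<dots> \<noteq> 0" using \<open>h \<noteq> 0\<close> by (simp add: pochhammer_fact[symmetric])
  finally show False using assms[of "degree h"] by (simp add: deriv_at_1_def)
qed

lemma coeff_snd_var_mult: "coeff (snd_var * f) j = (if j = 0 then 0 else coeff f (j - 1))"
  by (cases j) (simp_all add: mult_pCons_left)

lemma coeff_fst_var_mult: "coeff (fst_var * f) j = [:0, 1:] * coeff f j"
  by (simp add: mult_pCons_left)

lemma coeff_scale2: "coeff (scale2 r f) j = smult r (coeff f j)"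
  by (simp add: scale2_def mult_pCons_left)

lemma coeff_deriv_v: "coeff (deriv_v f) j = smult (real (Suc j)) (coeff f (Suc j))"
  by (simp add: deriv_v_def coeff_pderiv of_nat_poly mult_pCons_left del: of_nat_Suc)

lemma eval2_1_0: "eval2 f 1 0 = deriv_at_1 0 (coeff f 0)"
  by (simp add: eval2_def deriv_at_1_def poly_0_coeff_0)

lemma eval2_deriv_1_0: "eval2 ((deriv_u ^^ r) ((deriv_v ^^ s) f)) 1 0 = fact s * deriv_at_1 r (coeff f s)"
proof -
  have u: "coeff ((deriv_u ^^ r) g) j = (pderiv ^^ r) (coeff g j)" for g j
    by (induction r) (simp_all add: coeff_deriv_u)
  have "coeff ((deriv_v ^^ s) f) 0 = pochhammer 1 s * coeff f s"
    using coeff_higher_pderiv[of s f 0] by (simp add: deriv_v_def[abs_def])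
  also have "pochhammer (1::real poly) s = [:fact s:]"
    by (metis of_nat_poly of_nat_fact pochhammer_fact)
  finally have v: "coeff ((deriv_v ^^ s) f) 0 = smult (fact s) (coeff f s)" by (simp add: mult_pCons_left)
  show ?thesis
    by (simp add: eval2_1_0 u v deriv_at_1_def higher_pderiv_smult)
qed

context koornwinder
begin

section \<open>Recursions for common eigenfunctions\<close>

definition common_eigenfunction :: "poly2 \<Rightarrow> real \<Rightarrow> real \<Rightarrow> bool" where
  "common_eigenfunction f \<mu> \<nu> \<longleftrightarrow> angular_op f = scale2 \<mu> f \<and> radial_op f = scale2 \<nu> f"

text \<open>Comparison of the coefficients of v^j in the angular eigenvalue equation.\<close>

lemma angular_recurrence:
  assumes "common_eigenfunction f \<mu> \<nu>"
  shows "smult (real (Suc j) * (real (Suc j) + \<alpha>) / 4) ([:0, 1:] * ([:0, 1:] * coeff f (Suc j))) =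
    smult (\<mu> + real j * (real j + a)) (coeff f j)"
proof -
  have vv: "coeff (snd_var * deriv_v (deriv_v f)) j = smult (real j * real (Suc j)) (coeff f (Suc j))"
    by (cases j) (simp_all add: coeff_snd_var_mult coeff_deriv_v mult.commute)
  have vvv: "coeff (snd_var * (snd_var * deriv_v (deriv_v f))) j = smult (real j * (real j - 1)) (coeff f j)"
  proof (cases j)
    case (Suc i)
    then show ?thesis by (cases i) (simp_all add: coeff_snd_var_mult coeff_deriv_v algebra_simps)
  qed (simp add: coeff_snd_var_mult)
  have v: "coeff (snd_var * deriv_v f) j = smult (real j) (coeff f j)"
    by (cases j) (simp_all add: coeff_snd_var_mult coeff_deriv_v)
  have "coeff (angular_op f) j = smult \<mu> (coeff f j)"
    using assms by (simp add: common_eigenfunction_def coeff_scale2)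
  note eq = this[unfolded angular_op_def coeff_add coeff_diff coeff_scale2 coeff_fst_var_mult vv vvv v
    coeff_deriv_v mult_smult_right]
  show ?thesis
  proof (rule poly_eqI)
    fix n
    define y where "y = coeff ([:0, 1:] * ([:0, 1:] * coeff f (Suc j))) n"
    define z where "z = coeff (coeff f j) n"
    from arg_cong[OF eq, of "\<lambda>p. coeff p n"]
    have "1 / 4 * (real j * real (Suc j) * y) - real j * (real j - 1) * z
        + (\<alpha> + 1) / 4 * (real (Suc j) * y) - (a + 1) * (real j * z) = \<mu> * z"
      by (simp only: coeff_add coeff_diff coeff_smult y_def z_def)
    then have "real (Suc j) * (real (Suc j) + \<alpha>) / 4 * y = (\<mu> + real j * (real j + a)) * z"
      by (simp add: field_simps)
    then show "coeff (smult (real (Suc j) * (real (Suc j) + \<alpha>) / 4) ([:0, 1:] * ([:0, 1:] * coeff f (Suc j)))) n =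
        coeff (smult (\<mu> + real j * (real j + a)) (coeff f j)) n"
      by (simp only: coeff_smult y_def z_def)
  qed
qed

text \<open>The coefficient of v^0 in the radial eigenvalue equation, times u. The term with
  \<open>coeff f 1\<close> is eliminated by \<open>angular_recurrence\<close> at 0; what remains is
  an ODE for f(u, 0) with leading coefficient u^2 - u^3, which vanishes at u = 1.\<close>

lemma radial_equation:
  assumes "common_eigenfunction f \<mu> \<nu>" and "g = coeff f 0" and "x = [:0, 1:]"
  shows "x * (x * pderiv (pderiv g)) + smult (2 * a + 1) (x * pderiv g) + smult (4 * \<mu>) g
    - (x * (x * (x * pderiv (pderiv g))) + smult (1 + c) (x * (x * pderiv g))) = smult \<nu> (x * g)"
proof -
  have e: "coeff (euler_op h) 0 = x * pderiv (coeff h 0)" for h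
    unfolding euler_op_def coeff_add coeff_scale2 coeff_fst_var_mult coeff_snd_var_mult coeff_deriv_u assms(3)
    by simp
  have "coeff (radial_op f) 0 = smult \<nu> g"
    using assms by (simp add: common_eigenfunction_def coeff_scale2)
  then have "x * pderiv (pderiv g) + smult (2 * a + 1) (pderiv g) + smult (\<alpha> + 1) (x * coeff f 1)
      - (x * pderiv (x * pderiv g) + smult c (x * pderiv g)) = smult \<nu> g"
    unfolding radial_op_def coeff_add coeff_diff coeff_scale2 coeff_fst_var_mult coeff_snd_var_mult
      coeff_deriv_u coeff_deriv_v e assms(2,3) by simp
  then have "x * (x * pderiv (pderiv g)) + smult (2 * a + 1) (x * pderiv g) + smult (\<alpha> + 1) (x * (x * coeff f 1))
      - (x * (x * pderiv (x * pderiv g)) + smult c (x * (x * pderiv g))) = smult \<nu> (x * g)"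
    by (metis (no_types, lifting) distrib_left mult_smult_right right_diff_distrib)
  moreover have "smult (\<alpha> + 1) (x * (x * coeff f 1)) = smult (4 * \<mu>) g"
    using arg_cong[OF angular_recurrence[OF assms(1), of 0], of "smult 4"]
    unfolding assms(2,3) by (simp add: add.commute add_divide_distrib)
  moreover have "pderiv (x * pderiv g) = pderiv g + x * pderiv (pderiv g)"
    by (simp add: assms(3) pderiv_mult pderiv_pCons)
  ultimately show ?thesis by (simp add: algebra_simps smult_add_left)
qed

text \<open>One polynomial \<open>T\<close> serves all common eigenfunctions and eigenvalues; this
  uniformity is what later makes the eigenvalue of an operator a polynomial in \<nu> and
  \<mu>.\<close>

definition spectral :: "(poly2 \<Rightarrow> real \<Rightarrow> real \<Rightarrow> real) \<Rightarrow> bool" where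
  "spectral \<phi> \<longleftrightarrow>
    (\<exists>T. \<forall>f \<mu> \<nu>. common_eigenfunction f \<mu> \<nu> \<longrightarrow> \<phi> f \<mu> \<nu> = eval2 T \<nu> \<mu> * eval2 f 1 0)"

lemma spectral_zero: "spectral (\<lambda>f \<mu> \<nu>. 0)"
  unfolding spectral_def by (rule exI[of _ 0]) simp

lemma spectral_add: "spectral \<phi> \<Longrightarrow> spectral \<psi> \<Longrightarrow> spectral (\<lambda>f \<mu> \<nu>. \<phi> f \<mu> \<nu> + \<psi> f \<mu> \<nu>)"
  unfolding spectral_def by (elim exE, rule_tac x = "T + Ta" in exI) (simp add: distrib_right)

lemma spectral_cmult: "spectral \<phi> \<Longrightarrow> spectral (\<lambda>f \<mu> \<nu>. r * \<phi> f \<mu> \<nu>)"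
  unfolding spectral_def by (elim exE, rule_tac x = "scale2 r T" in exI) simp

text \<open>With r = 0 allowed, a vanishing coefficient discards terms whose truncated index is out
  of reach of the induction hypothesis.\<close>

lemma spectral_cmult_0: "(r \<noteq> 0 \<Longrightarrow> spectral \<phi>) \<Longrightarrow> spectral (\<lambda>f \<mu> \<nu>. r * \<phi> f \<mu> \<nu>)"
  using spectral_cmult[of \<phi> r] spectral_zero by (cases "r = 0") auto

lemma spectral_fst: "spectral \<phi> \<Longrightarrow> spectral (\<lambda>f \<mu> \<nu>. \<mu> * \<phi> f \<mu> \<nu>)"
  unfolding spectral_def by (elim exE, rule_tac x = "snd_var * T" in exI) simp

lemma spectral_snd: "spectral \<phi> \<Longrightarrow> spectral (\<lambda>f \<mu> \<nu>. \<nu> * \<phi> f \<mu> \<nu>)"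
  unfolding spectral_def by (elim exE, rule_tac x = "fst_var * T" in exI) simp

lemmas spectral_intros = spectral_add spectral_fst spectral_snd spectral_cmult_0

lemma spectral_solve:
  assumes "spectral \<psi>" "r \<noteq> 0"
    and "\<And>f \<mu> \<nu>. common_eigenfunction f \<mu> \<nu> \<Longrightarrow> r * \<phi> f \<mu> \<nu> = \<psi> f \<mu> \<nu>"
  shows "spectral \<phi>"
proof -
  have "spectral (\<lambda>f \<mu> \<nu>. inverse r * \<psi> f \<mu> \<nu>)" using assms(1) by (rule spectral_cmult)
  then obtain T where "\<forall>f \<mu> \<nu>. common_eigenfunction f \<mu> \<nu> \<longrightarrow>
      inverse r * \<psi> f \<mu> \<nu> = eval2 T \<nu> \<mu> * eval2 f 1 0"
    by (auto simp: spectral_def)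
  then show ?thesis
    unfolding spectral_def using assms(2,3) by (intro exI[of _ T]) (auto simp: field_simps)
qed

text \<open>
  The coefficient of the highest derivative in the recursion at \<open>u = 1\<close> is \<open>- (n + \<gamma> + 1)\<close>, and in the
  recursion at \<open>v = 0\<close> it is a multiple of \<open>j + 1 + \<alpha>\<close>; neither vanishes since \<open>\<alpha>, \<gamma> > -1\<close>.
\<close>

lemma spectral_deriv_at_1_coeff_0: "spectral (\<lambda>f \<mu> \<nu>. deriv_at_1 i (coeff f 0))"
proof (induction i rule: less_induct)
  case (less i)
  show ?case
  proof (cases i)
    case 0
    then show ?thesis unfolding spectral_def by (intro exI[of _ 1]) (simp add: eval2_1_0)
  next
    case (Suc n)
    let ?d = "\<lambda>k f. deriv_at_1 k (coeff f 0)"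
    let ?n = "real n"
    show ?thesis
    proof (rule spectral_solve)
      show "- (?n + \<gamma> + 1) \<noteq> 0" using \<gamma> by simp
      show "spectral (\<lambda>f \<mu> \<nu>. \<nu> * ?d n f + \<nu> * (?n * ?d (n - 1) f) + \<mu> * ((-4) * ?d n f)
          + (2 * ?n * (?n - 1) + 2 * (1 + c) * ?n - (2 * a + 1) * ?n) * ?d n f
          + ?n * ((?n - 1) * (?n - 2) + (1 + c) * (?n - 1)) * ?d (n - 1) f)"
        using less.IH[of n] less.IH[of "n - 1"] Suc by (intro spectral_intros) auto
      fix f \<mu> \<nu> assume f: "common_eigenfunction f \<mu> \<nu>"
      define D where "D k = ?d k f" for k
      \<comment> \<open>The n-th derivative of \<open>radial_equation\<close> at 1; the terms of
        order n + 2 cancel, since u^2 - u^3 vanishes there.\<close>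
      have eq: "D (Suc (Suc n)) + ?n * D (Suc (Suc (n - 1))) + ?n * (D (Suc (Suc (n - 1))) + real (n - 1) * D (Suc (Suc (n - 1 - 1))))
          + (2 * a + 1) * (D (Suc n) + ?n * D (Suc (n - 1))) + 4 * \<mu> * D n
          - (D (Suc (Suc n)) + ?n * D (Suc (Suc (n - 1))) + ?n * (D (Suc (Suc (n - 1))) + real (n - 1) * D (Suc (Suc (n - 1 - 1))))
            + ?n * (D (Suc (Suc (n - 1))) + real (n - 1) * D (Suc (Suc (n - 1 - 1)))
              + real (n - 1) * (D (Suc (Suc (n - 1 - 1))) + real (n - 1 - 1) * D (Suc (Suc (n - 1 - 1 - 1)))))
            + (1 + c) * (D (Suc n) + ?n * D (Suc (n - 1)) + ?n * (D (Suc (n - 1)) + real (n - 1) * D (Suc (n - 1 - 1)))))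
          = \<nu> * (D n + ?n * D (n - 1))"
        using arg_cong[OF radial_equation[OF f refl refl], of "deriv_at_1 n"]
        unfolding deriv_at_1_simps deriv_at_1_x_mult D_def .
      \<comment> \<open>Small n are treated separately because the iterated differences n - 1, n - 1
        - 1, ... truncate.\<close>
      consider "n = 0" | "n = 1" | m where "n = Suc (Suc m)" by (metis One_nat_def not0_implies_Suc)
      then have "- (?n + \<gamma> + 1) * D (Suc n) = \<nu> * D n + \<nu> * (?n * D (n - 1)) + \<mu> * ((-4) * D n)
          + (2 * ?n * (?n - 1) + 2 * (1 + c) * ?n - (2 * a + 1) * ?n) * D n
          + ?n * ((?n - 1) * (?n - 2) + (1 + c) * (?n - 1)) * D (n - 1)"
      proof cases
        case 3
        show ?thesis using eq unfolding 3 by (cases m) (simp_all add: c_def algebra_simps)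
      qed (use eq in \<open>simp_all add: c_def algebra_simps\<close>)
      then show "- (?n + \<gamma> + 1) * ?d i f = \<nu> * ?d n f + \<nu> * (?n * ?d (n - 1) f) + \<mu> * ((-4) * ?d n f)
          + (2 * ?n * (?n - 1) + 2 * (1 + c) * ?n - (2 * a + 1) * ?n) * ?d n f
          + ?n * ((?n - 1) * (?n - 2) + (1 + c) * (?n - 1)) * ?d (n - 1) f"
        by (simp only: D_def Suc)
    qed
  qed
qed

text \<open>Outer induction on the power of v by \<open>angular_recurrence\<close>. The inner
  induction on i is needed because the i-th derivative of u^2 h at u = 1 is that of h plus multiples
  of lower derivatives of h.\<close>

lemma spectral_deriv_at_1: "spectral (\<lambda>f \<mu> \<nu>. deriv_at_1 i (coeff f j))"
proof (induction j arbitrary: i)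
  case 0
  show ?case by (rule spectral_deriv_at_1_coeff_0)
next
  case (Suc j)
  show ?case
  proof (induction i rule: less_induct)
    case (less i)
    let ?d = "\<lambda>k f. deriv_at_1 k (coeff f (Suc j))"
    let ?k = "real (Suc j) * (real (Suc j) + \<alpha>) / 4"
    show ?case
    proof (rule spectral_solve)
      show "?k \<noteq> 0" using \<alpha> by simp
      show "spectral (\<lambda>f \<mu> \<nu>. \<mu> * deriv_at_1 i (coeff f j) + real j * (real j + a) * deriv_at_1 i (coeff f j)
          + (- 2 * ?k * real i) * ?d (i - 1) f + (- ?k * real i * (real i - 1)) * ?d (i - 2) f)"
        by (intro spectral_intros Suc.IH less.IH) auto
      fix f \<mu> \<nu> assume "common_eigenfunction f \<mu> \<nu>"
      from arg_cong[OF angular_recurrence[OF this, of j], of "deriv_at_1 i"]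
      show "?k * ?d i f = \<mu> * deriv_at_1 i (coeff f j) + real j * (real j + a) * deriv_at_1 i (coeff f j)
          + (- 2 * ?k * real i) * ?d (i - 1) f + (- ?k * real i * (real i - 1)) * ?d (i - 2) f"
        unfolding deriv_at_1_simps deriv_at_1_x2_mult by (simp only: algebra_simps)
    qed
  qed
qed

text \<open>All partial derivatives at the corner are multiples of f(1, 0), so f(1, 0) = 0 would
  annihilate the whole Taylor expansion.\<close>

lemma common_eigenfunction_nonzero_at_corner:
  assumes "common_eigenfunction f \<mu> \<nu>" "f \<noteq> 0"
  shows "eval2 f 1 0 \<noteq> 0"
proof
  assume "eval2 f 1 0 = 0"
  then have "deriv_at_1 i (coeff f j) = 0" for i j
    using spectral_deriv_at_1[of i j] assms(1) by (auto simp: spectral_def)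
  then have "coeff f j = 0" for j by (rule deriv_at_1_all_0_imp_eq_0)
  then show False using assms(2) by (simp add: poly_eq_iff)
qed

lemma spectral_diff_op: "is_diff_op D \<Longrightarrow> spectral (\<lambda>f \<mu> \<nu>. eval2 (D f) 1 0)"
proof (induction rule: is_diff_op_induct)
  case (monomial p r s)
  have "spectral (\<lambda>f \<mu> \<nu>. (eval2 p 1 0 * fact s) * deriv_at_1 r (coeff f s))"
    by (intro spectral_cmult spectral_deriv_at_1)
  then show ?case by (simp add: eval2_deriv_1_0 mult.assoc)
qed (simp_all add: spectral_zero spectral_add)

text \<open>The inner variable is replaced by \<open>radial_op\<close>, the outer one by \<open>angular_op\<close>.\<close>

definition poly_op :: "poly2 \<Rightarrow> poly2 \<Rightarrow> poly2" where
  "poly_op P f = (\<Sum>j\<le>degree P. \<Sum>i\<le>degree (coeff P j).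
     scale2 (coeff (coeff P j) i) ((radial_op ^^ i) ((angular_op ^^ j) f)))"

lemma is_diff_op_poly_op: "is_diff_op (poly_op P)"
proof -
  have ang: "is_diff_op (\<lambda>f. (angular_op ^^ j) f)" for j
    by (induction j) (simp_all add: is_diff_op_ident is_diff_op_angular)
  have "is_diff_op (\<lambda>f. (radial_op ^^ i) ((angular_op ^^ j) f))" for i j
    by (induction i) (simp_all add: ang is_diff_op_radial)
  then show ?thesis
    unfolding poly_op_def[abs_def] by (intro is_diff_op_sum is_diff_op_scale2) auto
qed

lemma poly_op_eigenfunction:
  assumes "common_eigenfunction f \<mu> \<nu>"
  shows "poly_op P f = scale2 (eval2 P \<nu> \<mu>) f"
proof -
  have ang: "(angular_op ^^ j) f = scale2 (\<mu> ^ j) f" for j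
    using assms by (induction j)
      (simp_all add: common_eigenfunction_def module_hom.scale[OF linear_op_angular] mult.commute)
  have rad: "(radial_op ^^ i) f = scale2 (\<nu> ^ i) f" for i
    using assms by (induction i)
      (simp_all add: common_eigenfunction_def module_hom.scale[OF linear_op_radial] mult.commute)
  have "(radial_op ^^ i) ((angular_op ^^ j) f) = scale2 (\<mu> ^ j * \<nu> ^ i) f" for i j
    by (simp add: ang rad module_hom.scale[OF linear_op_funpow[OF linear_op_radial]])
  then have "poly_op P f =
      scale2 (\<Sum>j\<le>degree P. \<Sum>i\<le>degree (coeff P j). coeff (coeff P j) i * (\<mu> ^ j * \<nu> ^ i)) f"
    by (simp add: poly_op_def poly2.scale_sum_left)
  also have "(\<Sum>j\<le>degree P. \<Sum>i\<le>degree (coeff P j). coeff (coeff P j) i * (\<mu> ^ j * \<nu> ^ i)) = eval2 P \<nu> \<mu>"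
    unfolding eval2_def poly_altdef[of P] poly_sum poly_mult poly_power
    by (simp add: poly_altdef[of "coeff P _"] sum_distrib_left sum_distrib_right mult_ac)
  finally show ?thesis .
qed

section \<open>The algebra isomorphism\<close>

lemma common_eigenfunction_q: "common_eigenfunction (q d) (angular_eigenvalue d) (radial_eigenvalue d)"
  by (simp add: common_eigenfunction_def angular_op_q radial_op_q)

lemma poly_op_q: "poly_op P (q d) = scale2 (eval2 P (radial_eigenvalue d) (angular_eigenvalue d)) (q d)"
  by (rule poly_op_eigenfunction[OF common_eigenfunction_q])

lemma linear_op_poly_op: "linear_op (poly_op P)"
  by (rule linear_op_diff_op[OF is_diff_op_poly_op])

lemma poly_op_in_algebra: "poly_op P \<in> diff_op_algebra \<alpha> \<gamma> \<kappa>"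
  using poly_op_q[of P "(n, k)" for n k] by (auto simp: diff_op_algebra_def is_diff_op_poly_op)

text \<open>The polynomial from \<open>spectral_diff_op\<close> does not depend on d. Dividing by
  the nonzero corner value of \<open>q d\<close> shows that \<open>D\<close> and
  \<open>poly_op P\<close> have the same eigenvalues on a spanning family.\<close>

lemma algebra_subset_range_poly_op:
  assumes "D \<in> diff_op_algebra \<alpha> \<gamma> \<kappa>"
  shows "\<exists>P. D = poly_op P"
proof -
  have D: "is_diff_op D" using assms by (simp add: diff_op_algebra_def)
  then obtain P where P: "\<And>f \<mu> \<nu>. common_eigenfunction f \<mu> \<nu> \<Longrightarrow> eval2 (D f) 1 0 = eval2 P \<nu> \<mu> * eval2 f 1 0"
    using spectral_diff_op[OF D] by (auto simp: spectral_def)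
  have "D (q d) = poly_op P (q d)" for d
  proof -
    obtain \<Lambda> where \<Lambda>: "D (q d) = scale2 \<Lambda> (q d)" using assms by (auto simp: diff_op_algebra_def)
    have "\<Lambda> * eval2 (q d) 1 0 = eval2 P (radial_eigenvalue d) (angular_eigenvalue d) * eval2 (q d) 1 0"
      using P[OF common_eigenfunction_q[of d]] by (simp add: \<Lambda>)
    then have "\<Lambda> = eval2 P (radial_eigenvalue d) (angular_eigenvalue d)"
      using common_eigenfunction_nonzero_at_corner[OF common_eigenfunction_q q_nonzero] by simp
    then show ?thesis by (simp add: \<Lambda> poly_op_q)
  qed
  then show ?thesis
    using linear_op_eqI[OF linear_op_diff_op[OF D] linear_op_poly_op span_q] by blast
qed

text \<open>Up to sign, the difference of two values is (m - n) (m + n + b), and m + n >= 1 when m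
  \<noteq> n.\<close>

lemma inj_mult_add:
  assumes "b > -1"
  shows "inj (\<lambda>n::nat. - (real n * (real n + b)))"
proof (rule injI)
  fix m n :: nat assume "- (real m * (real m + b)) = - (real n * (real n + b))"
  then have "(real m - real n) * (real m + real n + b) = 0" by (simp add: algebra_simps)
  moreover have "real m + real n + b > 0" if "m \<noteq> n"
  proof -
    have "m + n \<ge> 1" using that by auto
    then have "real m + real n \<ge> 1" by linarith
    then show ?thesis using assms by simp
  qed
  ultimately show "m = n" by fastforce
qed

text \<open>For fixed k the angular eigenvalue is constant while the radial one takes infinitely
  many values, and infinitely many angular eigenvalues occur; so a polynomial vanishing at all
  eigenvalue pairs is 0.\<close>

lemma inj_poly_op: "inj poly_op"
proof (rule injI)
  fix P Q assume eq: "poly_op P = poly_op Q"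
  define R where "R = P - Q"
  have R: "eval2 R (radial_eigenvalue d) (angular_eigenvalue d) = 0" for d
  proof -
    have "scale2 (eval2 P (radial_eigenvalue d) (angular_eigenvalue d)) (q d) =
        scale2 (eval2 Q (radial_eigenvalue d) (angular_eigenvalue d)) (q d)"
      using eq by (metis poly_op_q)
    then show ?thesis using q_nonzero by (simp add: R_def)
  qed
  have "R = 0"
  proof (rule eval2_eq_0_imp_eq_0)
    show "infinite (range (\<lambda>k. angular_eigenvalue (0, k)))"
      using inj_mult_add[of a] a_gt
      by (simp add: angular_eigenvalue_def range_inj_infinite)
  next
    fix b assume "b \<in> range (\<lambda>k. angular_eigenvalue (0, k))"
    then obtain k where k: "b = angular_eigenvalue (0, k)" by auto
    have "inj (\<lambda>n. radial_eigenvalue (n, k))"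
    proof (rule injI)
      fix m n assume "radial_eigenvalue (m, k) = radial_eigenvalue (n, k)"
      then have "m + 2 * k = n + 2 * k"
        using inj_mult_add[OF c_gt, THEN injD, of "m + 2 * k" "n + 2 * k"] by (simp add: radial_eigenvalue_def Let_def)
      then show "m = n" by simp
    qed
    then have "infinite (range (\<lambda>n. radial_eigenvalue (n, k)))" by (rule range_inj_infinite)
    moreover have "range (\<lambda>n. radial_eigenvalue (n, k)) \<subseteq> {x. eval2 R x b = 0}"
      using R[of "(n, k)" for n] by (auto simp: k angular_eigenvalue_def)
    ultimately show "infinite {x. eval2 R x b = 0}" using infinite_super by blast
  qed
  then show "P = Q" by (simp add: R_def)
qed

text \<open>Each identity is checked on the spanning family \<open>q\<close>, where all operators
  act by scalars; multiplicativity thus needs no commutator of \<open>radial_op\<close> and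
  \<open>angular_op\<close>.\<close>

lemma is_algebra_iso_poly_op: "is_algebra_iso poly_op (diff_op_algebra \<alpha> \<gamma> \<kappa>)"
  unfolding is_algebra_iso_def
proof (intro conjI allI)
  show "bij_betw poly_op UNIV (diff_op_algebra \<alpha> \<gamma> \<kappa>)"
    unfolding bij_betw_def using inj_poly_op poly_op_in_algebra algebra_subset_range_poly_op by blast
  show "poly_op 1 = id"
    by (rule linear_op_eqI[OF linear_op_poly_op _ span_q])
      (simp_all add: poly_op_q module_hom_iff poly2.module_axioms)
  show "poly_op (P + Q) = (\<lambda>f. poly_op P f + poly_op Q f)" for P Q
    by (rule linear_op_eqI[OF linear_op_poly_op _ span_q])
      (simp_all add: poly_op_q linear_op_diff_op is_diff_op_add is_diff_op_poly_op poly2.scale_left_distrib)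
  show "poly_op (P * Q) = poly_op P \<circ> poly_op Q" for P Q
    by (rule linear_op_eqI[OF linear_op_poly_op _ span_q])
      (simp_all add: poly_op_q o_def linear_op_compose linear_op_poly_op
        module_hom.scale[OF linear_op_poly_op] mult.commute)
  show "poly_op (scale2 r P) = (\<lambda>f. scale2 r (poly_op P f))" for r P
    by (rule linear_op_eqI[OF linear_op_poly_op _ span_q])
      (simp_all add: poly_op_q linear_op_compose linear_op_scale2 linear_op_poly_op)
qed

end

theorem corollary8p3:
  fixes \<alpha> \<gamma> \<kappa> :: real
  assumes "\<alpha> > -1" and "\<gamma> > -1" and "\<kappa> > -1" and "\<alpha> + \<kappa> > -3/2"
  shows "\<exists>\<Phi>. is_algebra_iso \<Phi> (diff_op_algebra \<alpha> \<gamma> \<kappa>)"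
proof -
  interpret koornwinder \<alpha> \<gamma> \<kappa> by unfold_locales (use assms in auto)
  show ?thesis using is_algebra_iso_poly_op by blast
qed

end
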